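(* Let $n$ and $m$ be positive integers, and let $\tilde{f}\in\mathrm{Sym}(\mathbb{F}_2^n)$ and $\tilde{g}\in\mathrm{Sym}(\mathbb{F}_2^m)$ be transition functions of FSRs such that $\tilde{f}$ is a De Bruijn cycle (a single cycle of length $2^n$) and $\tilde{g}$ is $\mathbb{F}_2$-linear. Let $P(X)\in\mathbb{F}_2[X]$ be the unique monic polynomial of degree $m$ such that $\tilde{g}$ can be represented, with respect to a suitable $\mathbb{F}_2$-basis of $\mathbb{F}_2^m$, by the companion matrix $\mathrm{Comp}(P(X))$. Write $P(X)=(X-1)^{e_0}\prod_{i=1}^r Q_i(X)^{e_i}$ with $e_0\in\mathbb{N}_0$, $e_i\in\mathbb{N}^+$ for $1\le i\le r$, and $X-1,Q_1(X),\ldots,Q_r(X)\in\mathbb{F}_2[X]$ pairwise distinct monic irreducible polynomials. Let $\pi_1:\mathbb{F}_2^n\to\mathbb{F}_2$ be the projection to the first coordinate and set $$\chi_{\tilde{f}}(X):=\sum_{t=0}^{2^n-1}\pi_1(\tilde{f}^t(\vec{0}))\,X^{2^n-1-t}\in\mathbb{F}_2[X].$$ Let $\Gamma\in\mathrm{Sym}(\mathbb{F}_2[X]/(P(X)))$ be given by $\Gamma(R(X)+(P(X)))=X^{2^n}R(X)+\chi_{\tilde{f}}(X)+(P(X))$, and let $\Gamma_0$ and $\Gamma_+$ be the reductions of $\Gamma$ modulo $(X-1)^{e_0}$ and modulo $\prod_{i=1}^r Q_i(X)^{e_i}$, respectively (i.e. the permutations given by the same formula on $\mathbb{F}_2[X]/((X-1)^{e_0})$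 and on $\mathbb{F}_2[X]/(\prod_{i=1}^r Q_i(X)^{e_i})$). For $i=1,\ldots,r$ let $\alpha_i$ be the multiplication by $X$ modulo $Q_i(X)^{e_i}$, and let $\alpha_+$ be the multiplication by $X$ modulo $\prod_{i=1}^r Q_i(X)^{e_i}$, which satisfies $\mathrm{CT}(\alpha_+)=\divideontimes_{i=1}^r\mathrm{CT}(\alpha_i)$. Write $e_0=a\cdot 2^n+b$ with $a,b\in\mathbb{Z}$ and $0\le b<2^n$. Then the following hold. 1. $\mathrm{CT}(\tilde{f}\ast\tilde{g})=\mathrm{BU}_{2^n}(\mathrm{CT}(\Gamma))$. 2. $\mathrm{CT}(\Gamma)=\mathrm{CT}(\Gamma_0)\divideontimes\mathrm{CT}(\Gamma_+)$. 3. $\mathrm{CT}(\Gamma_+)=\mathrm{CT}(\alpha_+^{2^n})=\mathrm{it}_{2^n}(\mathrm{CT}(\alpha_+))$. 4. $$\mathrm{CT}(\Gamma_0)=\begin{cases} x_1, & \text{if } e_0=0;\\ x_1^{2^{e_0}}, & \text{if } e_0>0,\ n\ge\lceil\log_2(e_0)\rceil,\text{ and }(X-1)^{e_0}\mid\chi_{\tilde{f}}(X);\\ x_2^{2^{e_0-1}}, & \text{if } e_0>0,\ n\ge\lceil\log_2(e_0)\rceil,\text{ and }(X-1)^{e_0}\nmid\chi_{\tilde{f}}(X);\\ x_{2^{\lfloor\log_2(a)\rfloor+1}}^{2^{e_0-\lfloor\log_2(a)\rfloor-1}}, & \text{if } e_0>0,\ n<\lceil\log_2(e_0)\rceil,\text{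 and }\log_2(a+1)\notin\mathbb{Z};\\ x_{a+1}^{2^{e_0}/(a+1)}, & \text{if } e_0>0,\ n<\lceil\log_2(e_0)\rceil,\ \log_2(a+1)\in\mathbb{Z},\text{ and }(X-1)^b\mid\chi_{\tilde{f}}(X);\\ x_{2a+2}^{2^{e_0-1}/(a+1)}, & \text{if } e_0>0,\ n<\lceil\log_2(e_0)\rceil,\ \log_2(a+1)\in\mathbb{Z},\text{ and }(X-1)^b\nmid\chi_{\tilde{f}}(X). \end{cases}$$
   Context: FSRs. An $n$-stage feedback shift register (FSR) with update function $f_1:\mathbb{F}_2^n\to\mathbb{F}_2$ has transition function $\tilde{f}:\mathbb{F}_2^n\to\mathbb{F}_2^n$, $(x_0,\ldots,x_{n-1})\mapsto(x_1,\ldots,x_{n-1},f_1(x_0,\ldots,x_{n-1}))$; similarly $\tilde{g}$ on $\mathbb{F}_2^m$ with update function $g_1:\mathbb{F}_2^m\to\mathbb{F}_2$. The transition function of the cascaded connection of the first FSR into the second is $\tilde{f}\ast\tilde{g}:\mathbb{F}_2^{m+n}\to\mathbb{F}_2^{m+n}$, $$(x_0,\ldots,x_{m-1},y_0,\ldots,y_{n-1})\mapsto(x_1,\ldots,x_{m-1},\,g_1(x_0,\ldots,x_{m-1})+y_0,\,y_1,\ldots,y_{n-1},\,f_1(y_0,\ldots,y_{n-1})).$$ Companion matrix. For monic $P=X^d+a_{d-1}X^{d-1}+\cdots+a_0$, $\mathrm{Comp}(P)$ is the $(d\times d)$-matrix of multiplication by $X$ on $K[X]/(P)$ with respect to the basis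 $1,X,\ldots,X^{d-1}$ (ones on the subdiagonal, last column $(-a_0,\ldots,-a_{d-1})^T$, zeros elsewhere). Cycle types. The cycle type of a permutation $\sigma$ of a finite set is the monomial $\mathrm{CT}(\sigma)=\prod_{\ell\ge 1}x_\ell^{k_\ell}\in\mathbb{Q}[x_j:j\in\mathbb{N}^+]$, where $k_\ell$ is the number of cycles of $\sigma$ of length $\ell$ (fixed points count as cycles of length $1$; the permutation of a one-element set has cycle type $x_1$). The Wei–Xu product $\divideontimes$ is given on monomials by $$\prod_i x_i^{k_i}\divideontimes\prod_j x_j^{n_j}=\prod_{i,j}x_{\mathrm{lcm}(i,j)}^{k_i n_j\gcd(i,j)};$$ the empty $\divideontimes$-product is $x_1$. For a positive integer $\ell$, $\mathrm{BU}_\ell$ is the unique $\mathbb{Q}$-algebra endomorphism of $\mathbb{Q}[x_j:j\in\mathbb{N}^+]$ with $\mathrm{BU}_\ell(x_j)=x_{\ell j}$ for all $j$. For a cycle type $\gamma=\prod_\ell x_\ell^{k_\ell}$ and an integer $t$, $\mathrm{it}_t(\gamma)$ denotes the cycle type of the $t$-th iterate of any permutation of cycle type $\gamma$, i.e. $\mathrm{it}_t(\gamma)=\prod_\ell x_{\ell/\gcd(\ell,t)}^{k_\ell\gcd(\ell,t)}$. $\mathbb{N}_0$ is the set of nonnegative integers and $\mathbb{N}^+$ the set of positive integers. *)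

theory Defs
  imports
    Complex_Main
    "HOL-Library.Z2"
    "HOL-Library.Poly_Mapping"
    "HOL-Combinatorics.Orbits"
    "HOL-Algebra.QuotRing"
    "HOL-Computational_Algebra.Polynomial_Factorial"
    "Jordan_Normal_Form.VS_Connect"
begin

section \<open>Feedback shift registers\<close>

text \<open>The field with two elements is \<^typ>\<open>bit\<close>, and the space of vectors of length \<open>n\<close> over
  it is \<^term>\<open>carrier_vec n :: bit vec set\<close>. Update functions are only ever applied to
  vectors of the right length.\<close>

definition fsr :: "nat \<Rightarrow> (bit vec \<Rightarrow> bit) \<Rightarrow> bit vec \<Rightarrow> bit vec" where
  "fsr n f1 x = vec n (\<lambda>i. if i < n - 1 then x $ (i + 1) else f1 x)"

definition cascade ::
  "nat \<Rightarrow> (bit vec \<Rightarrow> bit) \<Rightarrow> nat \<Rightarrow> (bit vec \<Rightarrow> bit) \<Rightarrow> bit vec \<Rightarrow> bit vec" where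
  "cascade n f1 m g1 z =
     (let x = vec_first z m; y = vec_last z n
      in vec m (\<lambda>i. if i < m - 1 then x $ (i + 1) else g1 x + y $ 0) @\<^sub>v fsr n f1 y)"

definition chi :: "nat \<Rightarrow> (bit vec \<Rightarrow> bit vec) \<Rightarrow> bit poly" where
  "chi n f = (\<Sum>t = 0..2 ^ n - 1. monom ((f ^^ t) (0\<^sub>v n) $ 0) (2 ^ n - 1 - t))"


section \<open>Companion matrices\<close>

definition companion_mat :: "'a :: comm_ring_1 poly \<Rightarrow> 'a mat" where
  "companion_mat P = mat (degree P) (degree P)
     (\<lambda>(i, j). if j = degree P - 1 then - coeff P i else if i = j + 1 then 1 else 0)"

text \<open>\<open>M\<close> is the matrix of \<open>g\<close> with respect to some ordered basis \<open>bs\<close>: its \<open>j\<close>-th column is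
  the coordinate vector of the image of the \<open>j\<close>-th basis element.\<close>

definition represented_by :: "nat \<Rightarrow> ('a :: field vec \<Rightarrow> 'a vec) \<Rightarrow> 'a mat \<Rightarrow> bool" where
  "represented_by m g M \<longleftrightarrow>
     (\<exists>bs. length bs = m \<and> distinct bs \<and>
        vectorspace.basis class_ring (module_vec TYPE('a) m) (set bs) \<and>
        (\<forall>j<m. g (bs ! j) = mat_of_cols m bs *\<^sub>v col M j))"


section \<open>Permutations of residue class rings\<close>

definition quot_ring :: "bit poly \<Rightarrow> bit poly set ring" where
  "quot_ring P = class_ring Quot (PIdl\<^bsub>class_ring\<^esub> P)"

definition residue_class :: "bit poly \<Rightarrow> bit poly \<Rightarrow> bit poly set" where
  "residue_class P R = (PIdl\<^bsub>class_ring\<^esub> P) +>\<^bsub>class_ring\<^esub> R"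

definition mult_X :: "bit poly \<Rightarrow> bit poly set \<Rightarrow> bit poly set" where
  "mult_X P C = residue_class P [:0, 1:] \<otimes>\<^bsub>quot_ring P\<^esub> C"

definition Gamma :: "nat \<Rightarrow> (bit vec \<Rightarrow> bit vec) \<Rightarrow> bit poly \<Rightarrow> bit poly set \<Rightarrow> bit poly set" where
  "Gamma n f P C =
     residue_class P ([:0, 1:] ^ (2 ^ n)) \<otimes>\<^bsub>quot_ring P\<^esub> C \<oplus>\<^bsub>quot_ring P\<^esub> residue_class P (chi n f)"

lemma ideal_PIdl: "ideal (PIdl\<^bsub>class_ring\<^esub> P) (class_ring :: bit poly ring)"
proof -
  have "cring (class_ring :: bit poly ring)" by (rule class_cring.cring_axioms)
  then show ?thesis by (rule cring.cgenideal_ideal) simp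
qed

lemma carrier_quot_ring: "carrier (quot_ring P) = range (residue_class P)"
  by (auto simp: quot_ring_def FactRing_def A_RCOSETS_def' residue_class_def)

lemma residue_class_add:
  "residue_class P R \<oplus>\<^bsub>quot_ring P\<^esub> residue_class P S = residue_class P (R + S)"
  using ring_hom_add[OF ideal.rcos_ring_hom[OF ideal_PIdl[of P]], of R S]
  by (simp add: quot_ring_def residue_class_def)

lemma residue_class_mult:
  "residue_class P R \<otimes>\<^bsub>quot_ring P\<^esub> residue_class P S = residue_class P (R * S)"
  using ring_hom_mult[OF ideal.rcos_ring_hom[OF ideal_PIdl[of P]], of R S]
  by (simp add: quot_ring_def residue_class_def)

lemma residue_class_eq_iff: "residue_class P R = residue_class P S \<longleftrightarrow> P dvd R - S"
proof -
  have *: "residue_class P R = {x * P + R |x. True}" for R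
    by (auto simp: residue_class_def a_r_coset_def' cgenideal_def)
  show ?thesis
  proof
    assume "residue_class P R = residue_class P S"
    moreover have "R \<in> residue_class P R"
      unfolding * by (rule CollectI, rule exI[of _ 0]) simp
    ultimately obtain x where "R = x * P + S" unfolding * by auto
    then show "P dvd R - S" by simp
  next
    assume "P dvd R - S"
    then obtain c where c: "R = S + P * c" by (metis add_diff_cancel_left' dvdE diff_add_cancel add.commute)
    have 1: "\<exists>y. x * P + R = y * P + S" for x
      by (rule exI[of _ "x + c"]) (simp add: c algebra_simps)
    have 2: "\<exists>y. x * P + S = y * P + R" for x
      by (rule exI[of _ "x - c"]) (simp add: c algebra_simps)
    show "residue_class P R = residue_class P S"
      unfolding * using 1 2 by auto
  qed
qed

lemma mult_X_residue_class: "mult_X P (residue_class P R) = residue_class P ([:0, 1:] * R)"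
  by (simp only: mult_X_def residue_class_mult)

lemma Gamma_residue_class:
  "Gamma n f P (residue_class P R) = residue_class P ([:0, 1:] ^ (2 ^ n) * R + chi n f)"
  by (simp only: Gamma_def residue_class_mult residue_class_add)


section \<open>Cycle types\<close>

text \<open>Polynomials over the rationals in variables indexed by natural numbers. The variable with
  index \<open>0\<close> is never used.\<close>

type_synonym ct_poly = "(nat \<Rightarrow>\<^sub>0 nat) \<Rightarrow>\<^sub>0 rat"

definition ct_const :: "rat \<Rightarrow> ct_poly" where
  "ct_const c = Poly_Mapping.single 0 c"

definition ct_var :: "nat \<Rightarrow> ct_poly" where
  "ct_var j = Poly_Mapping.single (Poly_Mapping.single j 1) 1"

text \<open>The cycles of a permutation \<open>\<sigma>\<close> of \<open>A\<close> are its orbits; none is longer than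
  \<^term>\<open>card A\<close>.\<close>

definition cycle_type :: "'a set \<Rightarrow> ('a \<Rightarrow> 'a) \<Rightarrow> ct_poly" where
  "cycle_type A \<sigma> = (\<Prod>l\<in>{1..card A}. ct_var l ^ card {C \<in> orbit \<sigma> ` A. card C = l})"

text \<open>The bilinear extension of the Wei--Xu product of monomials.\<close>

definition wei_xu :: "ct_poly \<Rightarrow> ct_poly \<Rightarrow> ct_poly"  (infixl \<open>\<otimes>\<^sub>W\<close> 70) where
  "p \<otimes>\<^sub>W q =
     (\<Sum>k\<in>Poly_Mapping.keys p. \<Sum>n\<in>Poly_Mapping.keys q.
        ct_const (Poly_Mapping.lookup p k * Poly_Mapping.lookup q n) *
        (\<Prod>i\<in>Poly_Mapping.keys k. \<Prod>j\<in>Poly_Mapping.keys n.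
           ct_var (lcm i j) ^ (Poly_Mapping.lookup k i * Poly_Mapping.lookup n j * gcd i j)))"

primrec wei_xu_prod :: "(nat \<Rightarrow> ct_poly) \<Rightarrow> nat \<Rightarrow> ct_poly" where
  "wei_xu_prod \<gamma> 0 = ct_var 1"
| "wei_xu_prod \<gamma> (Suc r) = wei_xu_prod \<gamma> r \<otimes>\<^sub>W \<gamma> (Suc r)"

text \<open>The algebra endomorphism that sends the \<open>j\<close>-th variable to \<open>\<phi> j\<close>.\<close>

definition ct_subst :: "(nat \<Rightarrow> ct_poly) \<Rightarrow> ct_poly \<Rightarrow> ct_poly" where
  "ct_subst \<phi> p =
     (\<Sum>k\<in>Poly_Mapping.keys p. ct_const (Poly_Mapping.lookup p k) *
        (\<Prod>j\<in>Poly_Mapping.keys k. \<phi> j ^ Poly_Mapping.lookup k j))"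

definition BU :: "nat \<Rightarrow> ct_poly \<Rightarrow> ct_poly" where
  "BU l = ct_subst (\<lambda>j. ct_var (l * j))"

text \<open>On a monomial with exponents \<open>k l\<close> this gives the product of the
  \<open>ct_var (l / gcd l t) ^ (k l * gcd l t)\<close>.\<close>

definition ct_iterate :: "int \<Rightarrow> ct_poly \<Rightarrow> ct_poly" where
  "ct_iterate t =
     ct_subst (\<lambda>l. let d = nat (gcd (int l) t) in ct_var (l div d) ^ d)"

lemma ct_subst_superset:
  assumes "finite S" "Poly_Mapping.keys p \<subseteq> S"
  shows "ct_subst \<phi> p = (\<Sum>k\<in>S. ct_const (Poly_Mapping.lookup p k) *
        (\<Prod>j\<in>Poly_Mapping.keys k. \<phi> j ^ Poly_Mapping.lookup k j))"
  unfolding ct_subst_def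
  by (rule sum.mono_neutral_left) (use assms in \<open>auto simp: in_keys_iff ct_const_def\<close>)

lemma ct_const_add: "ct_const (a + b) = ct_const a + ct_const b"
  by (simp add: ct_const_def single_add)

lemma ct_const_mult: "ct_const (a * b) = ct_const a * ct_const b"
  by (simp add: ct_const_def mult_single)

lemma ct_subst_add: "ct_subst \<phi> (p + q) = ct_subst \<phi> p + ct_subst \<phi> q"
proof -
  let ?S = "Poly_Mapping.keys p \<union> Poly_Mapping.keys q"
  have "Poly_Mapping.keys (p + q) \<subseteq> ?S" by (rule Poly_Mapping.keys_add)
  then show ?thesis
    by (simp add: ct_subst_superset[of ?S] lookup_add ct_const_add distrib_right sum.distrib)
qed

lemma ct_subst_single:
  "ct_subst \<phi> (Poly_Mapping.single k c) =
     ct_const c * (\<Prod>j\<in>Poly_Mapping.keys k. \<phi> j ^ Poly_Mapping.lookup k j)"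
  by (subst ct_subst_superset[of "{k}"]) auto

lemma ct_subst_const: "ct_subst \<phi> (ct_const c) = ct_const c"
  by (simp add: ct_const_def[of c] ct_subst_single)

lemma ct_subst_var: "ct_subst \<phi> (ct_var j) = \<phi> j"
  by (simp add: ct_var_def ct_subst_single) (simp add: ct_const_def)

lemma ct_subst_mult_single:
  "ct_subst \<phi> (Poly_Mapping.single k c * Poly_Mapping.single l d) =
     ct_subst \<phi> (Poly_Mapping.single k c) * ct_subst \<phi> (Poly_Mapping.single l d)"
proof -
  let ?S = "Poly_Mapping.keys k \<union> Poly_Mapping.keys l"
  have *: "(\<Prod>j\<in>Poly_Mapping.keys u. \<phi> j ^ Poly_Mapping.lookup u j) =
        (\<Prod>j\<in>?S. \<phi> j ^ Poly_Mapping.lookup u j)"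
    if "Poly_Mapping.keys u \<subseteq> ?S" for u
    by (rule prod.mono_neutral_left) (use that in \<open>auto simp: in_keys_iff\<close>)
  show ?thesis
    unfolding mult_single ct_subst_single *[OF Poly_Mapping.keys_add]
      *[of k, OF Un_upper1] *[of l, OF Un_upper2]
    by (simp add: lookup_add power_add prod.distrib ct_const_mult mult_ac)
qed

lemma ct_poly_eq_sum:
  "p = (\<Sum>k\<in>Poly_Mapping.keys p. Poly_Mapping.single k (Poly_Mapping.lookup p k))"
  for p :: ct_poly
  by (rule poly_mapping_eqI) (auto simp: lookup_sum lookup_single when_def in_keys_iff)

lemma ct_subst_sum: "ct_subst \<phi> (\<Sum>i\<in>I. h i) = (\<Sum>i\<in>I. ct_subst \<phi> (h i))"
proof (induction I rule: infinite_finite_induct)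
  case (insert i I)
  then show ?case by (simp add: ct_subst_add)
qed (simp_all add: ct_subst_def)

lemma ct_subst_mult: "ct_subst \<phi> (p * q) = ct_subst \<phi> p * ct_subst \<phi> q"
proof -
  let ?s = "\<lambda>p k. Poly_Mapping.single k (Poly_Mapping.lookup p k) :: ct_poly"
  have "ct_subst \<phi> (p * q) =
      ct_subst \<phi> ((\<Sum>k\<in>Poly_Mapping.keys p. ?s p k) * (\<Sum>l\<in>Poly_Mapping.keys q. ?s q l))"
    by (simp flip: ct_poly_eq_sum)
  also have "\<dots> = ct_subst \<phi> (\<Sum>k\<in>Poly_Mapping.keys p. ?s p k) *
      ct_subst \<phi> (\<Sum>l\<in>Poly_Mapping.keys q. ?s q l)"
    by (simp only: sum_product ct_subst_sum ct_subst_mult_single)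
  also have "\<dots> = ct_subst \<phi> p * ct_subst \<phi> q"
    by (simp flip: ct_poly_eq_sum)
  finally show ?thesis .
qed

end

theory Submission
  imports Defs "HOL-Computational_Algebra.Field_as_Ring"
begin

text \<open>Write \<open>N = 2 ^ n\<close>. The De Bruijn register runs through a single cycle of length \<open>N\<close>, so
  every cycle of the cascade meets the states in which this register is zero, and it does so at
  every \<open>N\<close>-th step. The cascade is therefore a tower of height \<open>N\<close> over its return map
  to these states, and its cycle lengths are \<open>N\<close> times those of the return map
  (\<open>cycle_type_tower\<close>, \<open>cycle_type_cascade\<close>).

  To identify the return map, view the state space of the linear register \<open>g\<close> as a module over
  the polynomials on which \<open>X\<close> acts as \<open>g\<close>. The last unit vector generates it, because \<open>g\<close>
  is a shift, and \<open>P\<close> annihilates it, because \<open>g\<close> is represented by the companion matrix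
  (\<open>companion_annihilates\<close>). So states are residues modulo \<open>P\<close>. A step multiplies by
  \<open>X\<close> and adds the input bit times the generator, and by Horner's scheme \<open>N\<close> steps amount to
  \<open>R \<mapsto> X ^ N * R + chi\<close>, which is \<open>\<Gamma>\<close>.

  What is left is the cycle type of an affine map modulo \<open>P\<close>. The Chinese remainder theorem
  splits it along coprime factors, and the cycle type of a product of permutations is the Wei--Xu
  product of the cycle types (\<open>cycle_type_map_prod\<close>, \<open>cycle_type_affine_mod_mult\<close>). In characteristic
  two, \<open>X ^ N - 1 = (X - 1) ^ N\<close>. Away from \<open>X - 1\<close> this is a unit, so the affine map has a
  fixed point and is conjugate to its linear part (\<open>cycle_type_affine_mod_translate\<close>).

  Modulo \<open>Y ^ e\<close> with \<open>Y = X - 1\<close>, the linear part is \<open>1 + Y ^ N\<close>. Summing a geometric series,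
  the \<open>2 ^ j\<close>-th iterate moves \<open>R\<close> by \<open>Y ^ (N * (2 ^ j - 1)) * (Y ^ N * R + chi)\<close>. Since \<open>chi\<close> is
  nonzero and of degree less than \<open>N\<close>, the multiplicity of \<open>Y\<close> in the last factor is that of
  \<open>chi\<close>. Hence all cycles have the same length, the least power of two for which the total
  multiplicity is at least \<open>e = a * N + b\<close>; the cases of the formula are the outcomes of comparing
  this power of two with \<open>a + 1\<close> (\<open>unipotent_return_iff\<close>, \<open>cycle_type_unipotent\<close>).\<close>

section \<open>Cycle types from periods and fibres\<close>

text \<open>An orbit consists of the positive iterates only, so a point lies on its own orbit just when it is
  periodic. The permutations below are permutations of a carrier set that may be arbitrary outside
  of it; cutting them off to the identity there makes the theory of permutations applicable.\<close>

lemma self_in_orbit_finite_bij: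
  assumes "finite A" "bij_betw \<sigma> A A" "x \<in> A"
  shows "x \<in> orbit \<sigma> x"
proof -
  let ?p = "\<lambda>x. if x \<in> A then \<sigma> x else x"
  have "bij_betw ?p A A" using assms(2) by (simp cong: bij_betw_cong)
  then have "?p permutes A" by (rule bij_imp_permutes) simp
  then have "x \<in> orbit ?p x"
    using assms(1) by (meson permutation_permutes permutation_self_in_orbit)
  moreover have "orbit \<sigma> x = orbit ?p x"
    using assms(2,3) by (intro orbit_cong0[of _ A]) (auto dest: bij_betwE)
  ultimately show ?thesis by simp
qed

lemma funpow_fixes_iff_card_orbit_dvd:
  assumes "x \<in> orbit \<sigma> x"
  shows "(\<sigma> ^^ k) x = x \<longleftrightarrow> card (orbit \<sigma> x) dvd k"
proof -
  let ?d = "funpow_dist1 \<sigma> x x"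
  have card: "card (orbit \<sigma> x) = ?d"
    by (simp add: orbit_conv_funpow_dist1[OF assms] card_image inj_on_funpow_dist1[OF assms])
  have "(\<sigma> ^^ k) x = (\<sigma> ^^ (k mod ?d)) x"
    by (rule funpow_mod_eq[symmetric]) (rule funpow_dist1_prop[OF assms])
  moreover have "(\<sigma> ^^ (k mod ?d)) x = x \<longleftrightarrow> k mod ?d = 0"
  proof (cases "k mod ?d = 0")
    case False
    then show ?thesis using funpow_dist1_least[of "k mod ?d" \<sigma> x x] by simp
  qed simp
  ultimately show ?thesis unfolding card by (simp add: dvd_eq_mod_eq_0)
qed

lemma card_orbit_eqI:
  assumes "x \<in> orbit \<sigma> x" "\<And>k. (\<sigma> ^^ k) x = x \<longleftrightarrow> l dvd k"
  shows "card (orbit \<sigma> x) = l"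
  using funpow_fixes_iff_card_orbit_dvd[OF assms(1)] assms(2) by (metis dvd_antisym dvd_refl)

lemma cycle_type_eq_prod_orbits:
  assumes "finite A" "bij_betw \<sigma> A A"
  shows "cycle_type A \<sigma> = (\<Prod>C\<in>orbit \<sigma> ` A. ct_var (card C))"
proof -
  have sub: "orbit \<sigma> x \<subseteq> A" "card (orbit \<sigma> x) > 0" if "x \<in> A" for x
  proof -
    show s: "orbit \<sigma> x \<subseteq> A"
    proof
      fix y assume "y \<in> orbit \<sigma> x"
      then show "y \<in> A" by induct (use assms(2) that in \<open>auto dest: bij_betwE\<close>)
    qed
    show "card (orbit \<sigma> x) > 0"
      using self_in_orbit_finite_bij[OF assms that] s assms(1) by (metis card_gt_0_iff empty_iff finite_subset)
  qed
  have "cycle_type A \<sigma> = (\<Prod>l\<in>{1..card A}. \<Prod>C\<in>{C \<in> orbit \<sigma> ` A. card C = l}. ct_var (card C))"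
    unfolding cycle_type_def by simp
  also have "\<dots> = (\<Prod>C\<in>orbit \<sigma> ` A. ct_var (card C))"
    proof (rule prod.group)
    show "card ` orbit \<sigma> ` A \<subseteq> {1..card A}"
      using sub card_mono[OF assms(1)] by (auto simp: Suc_le_eq)
  qed (use assms(1) in auto)
  finally show ?thesis .
qed

text \<open>The counting principle behind all cycle types computed below. If a function \<open>\<kappa>\<close> is
  constant along \<open>\<sigma>\<close> and determines the period of a point, then the fibre over
  \<open>i\<close> is a union of cycles of one length \<open>L i\<close>; its cardinality gives their
  number. No cycle has to be exhibited: a cycle type follows from periods and fibre sizes, and
  periods follow from knowing which iterates fix a point.\<close>

lemma cycle_type_eqI:
  fixes \<kappa> :: "'a \<Rightarrow> 'i"
  assumes fin: "finite A" "bij_betw \<sigma> A A" "finite I"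
    and \<kappa>: "\<And>x. x \<in> A \<Longrightarrow> \<kappa> x \<in> I" "\<And>x. x \<in> A \<Longrightarrow> \<kappa> (\<sigma> x) = \<kappa> x"
    and L: "\<And>x. x \<in> A \<Longrightarrow> card (orbit \<sigma> x) = L (\<kappa> x)"
    and m: "\<And>i. i \<in> I \<Longrightarrow> L i > 0" "\<And>i. i \<in> I \<Longrightarrow> card {x \<in> A. \<kappa> x = i} = m i * L i"
  shows "cycle_type A \<sigma> = (\<Prod>i\<in>I. ct_var (L i) ^ m i)"
proof -
  let ?A = "\<lambda>i. {x \<in> A. \<kappa> x = i}"
  have self: "x \<in> orbit \<sigma> x" if "x \<in> A" for x
    using self_in_orbit_finite_bij[OF fin(1,2) that] .
  have orb: "y \<in> A \<and> \<kappa> y = \<kappa> x \<and> orbit \<sigma> y = orbit \<sigma> x" if "y \<in> orbit \<sigma> x" "x \<in> A" for x y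
    using that(1)
  proof induct
    case base
    then show ?case
      using that(2) \<kappa>(2) fin(2) self self_in_orbit_step by (metis bij_betwE)
  next
    case (step y)
    then show ?case
      using \<kappa>(2) fin(2) self self_in_orbit_step by (metis bij_betwE)
  qed
  have A: "A = (\<Union>i\<in>I. ?A i)" using \<kappa>(1) by auto
  have "cycle_type A \<sigma> = (\<Prod>C\<in>(\<Union>i\<in>I. orbit \<sigma> ` ?A i). ct_var (card C))"
    unfolding cycle_type_eq_prod_orbits[OF fin(1,2)] by (subst (1) A) (simp add: image_UN)
  also have "\<dots> = (\<Prod>i\<in>I. \<Prod>C\<in>orbit \<sigma> ` ?A i. ct_var (card C))"
  proof (rule prod.UNION_disjoint)
    show "\<forall>i\<in>I. \<forall>j\<in>I. i \<noteq> j \<longrightarrow> orbit \<sigma> ` ?A i \<inter> orbit \<sigma> ` ?A j = {}"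
      using orb self by fastforce
  qed (use fin in auto)
  also have "\<dots> = (\<Prod>i\<in>I. ct_var (L i) ^ m i)"
  proof (rule prod.cong[OF refl])
    fix i assume i: "i \<in> I"
    let ?O = "orbit \<sigma> ` ?A i"
    have "card (\<Union> ?O) = (\<Sum>C\<in>?O. card C)"
    proof (rule card_Union_disjoint)
      show "pairwise disjnt ?O"
        unfolding pairwise_def disjnt_def using orb by blast
      show "finite C" if "C \<in> ?O" for C
        using that orb fin(1) by (metis (no_types, lifting) finite_subset imageE mem_Collect_eq subsetI)
    qed
    also have "\<dots> = (\<Sum>C\<in>?O. L i)" using L by (intro sum.cong) auto
    also have "\<dots> = card ?O * L i" by simp
    also have "\<Union> ?O = ?A i" using orb self by blast
    finally have "card ?O = m i" using m[OF i] by simp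
    moreover have "(\<Prod>C\<in>?O. ct_var (card C)) = (\<Prod>C\<in>?O. ct_var (L i))"
      using L by (intro prod.cong) auto
    ultimately show "(\<Prod>C\<in>?O. ct_var (card C)) = ct_var (L i) ^ m i" by simp
  qed
  finally show ?thesis .
qed

lemma card_orbit_pos:
  assumes "finite A" "bij_betw \<sigma> A A" "x \<in> A"
  shows "card (orbit \<sigma> x) > 0"
  using self_in_orbit_finite_bij[OF assms] finite_orbit by (metis card_gt_0_iff empty_iff)

lemma orbit_eq_iff:
  assumes "finite A" "bij_betw \<sigma> A A" "x \<in> A" "y \<in> A"
  shows "orbit \<sigma> y = orbit \<sigma> x \<longleftrightarrow> y \<in> orbit \<sigma> x"
  using self_in_orbit_finite_bij[OF assms(1,2)] assms(3,4)
  by (metis cyclic_on_singleI orbit_cyclic_eq3)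

lemma fibre_orbit:
  assumes "finite A" "bij_betw \<sigma> A A" "C \<in> orbit \<sigma> ` A"
  shows "{x \<in> A. orbit \<sigma> x = C} = C"
proof -
  obtain x where x: "x \<in> A" "C = orbit \<sigma> x" using assms(3) by auto
  have "C \<subseteq> A"
  proof
    fix y assume "y \<in> C"
    then show "y \<in> A" unfolding x(2) by induct (use assms(2) x(1) in \<open>auto dest: bij_betwE\<close>)
  qed
  then show ?thesis using orbit_eq_iff[OF assms(1,2) x(1)] x(2) by auto
qed

lemma orbit_apply:
  assumes "finite A" "bij_betw \<sigma> A A" "x \<in> A"
  shows "orbit \<sigma> (\<sigma> x) = orbit \<sigma> x"
  by (rule self_in_orbit_step) (rule self_in_orbit_finite_bij[OF assms])

lemma funpow_conj:
  assumes "\<sigma> ` A \<subseteq> A" "\<And>x. x \<in> A \<Longrightarrow> \<phi> (\<sigma> x) = \<tau> (\<phi> x)" "x \<in> A"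
  shows "\<phi> ((\<sigma> ^^ k) x) = (\<tau> ^^ k) (\<phi> x) \<and> (\<sigma> ^^ k) x \<in> A"
  using assms by (induction k) auto

lemma cycle_type_conj:
  assumes fin: "finite A" "bij_betw \<sigma> A A" and \<phi>: "bij_betw \<phi> A B"
    and conj: "\<And>x. x \<in> A \<Longrightarrow> \<phi> (\<sigma> x) = \<tau> (\<phi> x)"
  shows "cycle_type B \<tau> = cycle_type A \<sigma>"
proof -
  have B: "B = \<phi> ` A" using \<phi> by (auto simp: bij_betw_def)
  have inj: "inj_on \<phi> A" using \<phi> by (auto simp: bij_betw_def)
  let ?\<psi> = "inv_into A \<phi>"
  have \<psi>: "?\<psi> (\<phi> x) = x" if "x \<in> A" for x using inj that by simp
  have \<sigma>A: "\<sigma> ` A \<subseteq> A" using fin(2) by (auto simp: bij_betw_def)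
  note pow = funpow_conj[of \<sigma> A \<phi> \<tau>, OF \<sigma>A conj]
  have \<tau>: "bij_betw \<tau> B B"
  proof -
    have "bij_betw (\<phi> \<circ> \<sigma> \<circ> ?\<psi>) B B"
      by (intro bij_betw_trans[of _ _ A] bij_betw_inv_into fin(2) \<phi>)
    then show ?thesis
      by (rule bij_betw_cong[THEN iffD1, rotated]) (auto simp: B \<psi> conj)
  qed
  have finB: "finite B" using B fin by simp
  have per: "card (orbit \<tau> (\<phi> x)) = card (orbit \<sigma> x)" if x: "x \<in> A" for x
  proof (rule card_orbit_eqI)
    show "\<phi> x \<in> orbit \<tau> (\<phi> x)" using self_in_orbit_finite_bij[OF finB \<tau>] x B by auto
    show "(\<tau> ^^ k) (\<phi> x) = \<phi> x \<longleftrightarrow> card (orbit \<sigma> x) dvd k" for k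
      using funpow_fixes_iff_card_orbit_dvd[OF self_in_orbit_finite_bij[OF fin x]] pow[OF _ x] x inj
      by (metis inj_onD)
  qed
  have "cycle_type B \<tau> = (\<Prod>C\<in>orbit \<sigma> ` A. ct_var (card C) ^ 1)"
  proof (rule cycle_type_eqI[where \<kappa> = "\<lambda>y. orbit \<sigma> (?\<psi> y)"])
    fix C assume C: "C \<in> orbit \<sigma> ` A"
    have "{y \<in> B. orbit \<sigma> (?\<psi> y) = C} = \<phi> ` {x \<in> A. orbit \<sigma> x = C}"
      by (auto simp: B \<psi>)
    then have "card {y \<in> B. orbit \<sigma> (?\<psi> y) = C} = card {x \<in> A. orbit \<sigma> x = C}"
      by (simp add: card_image inj_on_subset[OF inj])
    then show "card {y \<in> B. orbit \<sigma> (?\<psi> y) = C} = 1 * card C"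
      using fibre_orbit[OF fin C] by simp
    show "card C > 0" using C card_orbit_pos[OF fin] by auto
  next
    fix y assume "y \<in> B"
    then obtain x where x: "x \<in> A" "y = \<phi> x" using B by auto
    have \<sigma>x: "\<sigma> x \<in> A" using \<sigma>A x by auto
    show "orbit \<sigma> (?\<psi> y) \<in> orbit \<sigma> ` A" using x \<psi> by auto
    show "orbit \<sigma> (?\<psi> (\<tau> y)) = orbit \<sigma> (?\<psi> y)"
      using x \<psi>[OF x(1)] \<psi>[OF \<sigma>x] conj[OF x(1)] orbit_apply[OF fin x(1)] by simp
    show "card (orbit \<tau> y) = card (orbit \<sigma> (?\<psi> y))" using x \<psi> per by simp
  qed (use finB \<tau> fin in auto)
  then show ?thesis by (simp add: cycle_type_eq_prod_orbits[OF fin])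
qed

lemma cycle_type_const_period:
  assumes "finite A" "bij_betw \<sigma> A A" "l > 0" "\<And>x. x \<in> A \<Longrightarrow> card (orbit \<sigma> x) = l" "card A = k * l"
  shows "cycle_type A \<sigma> = ct_var l ^ k"
  using cycle_type_eqI[OF assms(1,2), of "{()}" "\<lambda>_. ()" "\<lambda>_. l" "\<lambda>_. k"] assms(3-) by simp

lemma ct_subst_prod: "ct_subst \<phi> (prod h I) = (\<Prod>i\<in>I. ct_subst \<phi> (h i))"
proof -
  have "ct_subst \<phi> 1 = 1" using ct_subst_const[of \<phi> 1] by (simp add: ct_const_def)
  then show ?thesis by (induction I rule: infinite_finite_induct) (simp_all add: ct_subst_mult)
qed

text \<open>On a cycle of length \<open>c\<close>, the iterate \<open>(\<sigma> ^^ t) ^^ k\<close> fixes a point if and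
  only if \<open>c\<close> divides \<open>t * k\<close>, that is, if \<open>c div gcd c t\<close> divides
  \<open>k\<close>. The cycle therefore breaks up into \<open>gcd c t\<close> equally long ones.\<close>

lemma cycle_type_funpow:
  assumes fin: "finite A" "bij_betw \<sigma> A A"
  shows "cycle_type A (\<sigma> ^^ t) = ct_iterate (int t) (cycle_type A \<sigma>)"
proof -
  let ?g = "\<lambda>C. gcd (card C) t"
  have \<sigma>t: "bij_betw (\<sigma> ^^ t) A A" using fin(2) by (rule bij_betw_funpow)
  have "cycle_type A (\<sigma> ^^ t) = (\<Prod>C\<in>orbit \<sigma> ` A. ct_var (card C div ?g C) ^ ?g C)"
  proof (rule cycle_type_eqI[where \<kappa> = "orbit \<sigma>"])
    fix C assume C: "C \<in> orbit \<sigma> ` A"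
    have pos: "card C > 0" using C card_orbit_pos[OF fin] by auto
    then show "card C div ?g C > 0" by (simp add: div_greater_zero_iff gcd_le1_nat)
    show "card {x \<in> A. orbit \<sigma> x = C} = ?g C * (card C div ?g C)"
      using fibre_orbit[OF fin C] by simp
  next
    fix x assume x: "x \<in> A"
    note self = self_in_orbit_finite_bij[OF fin x]
    show "orbit \<sigma> ((\<sigma> ^^ t) x) = orbit \<sigma> x"
      using orbit_eq_iff[OF fin x] funpow_in_orbit[OF self, of t] \<sigma>t x by (metis bij_betwE)
    show "card (orbit (\<sigma> ^^ t) x) = card (orbit \<sigma> x) div ?g (orbit \<sigma> x)"
    proof (rule card_orbit_eqI)
      show "x \<in> orbit (\<sigma> ^^ t) x" by (rule self_in_orbit_finite_bij[OF fin(1) \<sigma>t x])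
      fix k
      let ?c = "card (orbit \<sigma> x)"
      have "((\<sigma> ^^ t) ^^ k) x = x \<longleftrightarrow> ?c dvd t * k"
        using funpow_fixes_iff_card_orbit_dvd[OF self, of "t * k"] by (simp add: funpow_mult mult.commute)
      also have "\<dots> \<longleftrightarrow> ?c div gcd ?c t dvd k"
      proof -
        have g: "gcd ?c t > 0" using card_orbit_pos[OF fin x] by simp
        then obtain c' t' where ct: "?c = c' * gcd ?c t" "t = t' * gcd ?c t" "coprime c' t'"
          using gcd_coprime_exists by blast
        have "?c dvd t * k \<longleftrightarrow> c' * gcd ?c t dvd (t' * k) * gcd ?c t"
          by (subst (1) ct(1), subst (1) ct(2)) (simp only: mult_ac)
        also have "\<dots> \<longleftrightarrow> c' dvd t' * k" using g by simp
        also have "\<dots> \<longleftrightarrow> c' dvd k" using ct(3) by (simp add: coprime_dvd_mult_right_iff)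
        also have "c' = ?c div gcd ?c t"
          using g nonzero_mult_div_cancel_right[of "gcd ?c t" c'] unfolding ct(1)[symmetric] by simp
        finally show ?thesis .
      qed
      finally show "((\<sigma> ^^ t) ^^ k) x = x \<longleftrightarrow> ?c div gcd ?c t dvd k" .
    qed
  qed (use fin \<sigma>t in auto)
  also have "\<dots> = ct_iterate (int t) (cycle_type A \<sigma>)"
    unfolding cycle_type_eq_prod_orbits[OF fin] ct_iterate_def ct_subst_prod ct_subst_var
    by (simp add: Let_def)
  finally show ?thesis .
qed

lemma prod_ct_var_eq_single:
  "(\<Prod>i\<in>I. ct_var (h i)) = Poly_Mapping.single (\<Sum>i\<in>I. Poly_Mapping.single (h i) 1) 1"
  by (induction I rule: infinite_finite_induct) (simp_all add: ct_var_def mult_single)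

text \<open>A monomial built from a family of variables collects equal factors in its exponents. This
  translates between products over the exponents, as in the definitions by monomials, and products
  over the family, which is here the set of cycles.\<close>

lemma prod_keys_sum_single:
  fixes F :: "nat \<Rightarrow> ct_poly" and h :: "'i \<Rightarrow> nat"
  assumes "finite I"
  defines "k \<equiv> (\<Sum>i\<in>I. Poly_Mapping.single (h i) (1 :: nat))"
  shows "(\<Prod>l\<in>Poly_Mapping.keys k. F l ^ Poly_Mapping.lookup k l) = (\<Prod>i\<in>I. F (h i))"
proof -
  have lk: "Poly_Mapping.lookup k l = card {i \<in> I. h i = l}" for l
  proof -
    have "Poly_Mapping.lookup k l = (\<Sum>i\<in>I. if h i = l then 1 else 0)"
      unfolding k_def lookup_sum lookup_single when_def ..
    then show ?thesis using assms(1) by (simp add: sum.If_cases Int_def)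
  qed
  have "(\<Prod>i\<in>I. F (h i)) = (\<Prod>l\<in>h ` I. \<Prod>i\<in>{i \<in> I. h i = l}. F (h i))"
    using assms(1) by (intro prod.group[symmetric]) auto
  also have "\<dots> = (\<Prod>l\<in>h ` I. F l ^ Poly_Mapping.lookup k l)"
    by (simp add: lk)
  also have "h ` I = Poly_Mapping.keys k"
    using assms(1) by (auto simp: in_keys_iff lk card_eq_0_iff)
  finally show ?thesis by simp
qed

lemma wei_xu_prod_ct_var:
  assumes "finite I" "finite J"
  shows "(\<Prod>i\<in>I. ct_var (h i)) \<otimes>\<^sub>W (\<Prod>j\<in>J. ct_var (h' j)) =
    (\<Prod>i\<in>I. \<Prod>j\<in>J. ct_var (lcm (h i) (h' j)) ^ gcd (h i) (h' j))"
proof -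
  let ?k = "\<Sum>i\<in>I. Poly_Mapping.single (h i) (1 :: nat)"
  let ?n = "\<Sum>j\<in>J. Poly_Mapping.single (h' j) (1 :: nat)"
  let ?G = "\<lambda>i j. ct_var (lcm i j) ^ gcd i j"
  have "(\<Prod>i\<in>I. ct_var (h i)) \<otimes>\<^sub>W (\<Prod>j\<in>J. ct_var (h' j)) =
      (\<Prod>i\<in>Poly_Mapping.keys ?k. \<Prod>j\<in>Poly_Mapping.keys ?n. 
        ct_var (lcm i j) ^ (Poly_Mapping.lookup ?k i * Poly_Mapping.lookup ?n j * gcd i j))"
    unfolding wei_xu_def prod_ct_var_eq_single by (simp add: ct_const_def)
  also have "\<dots> = (\<Prod>i\<in>Poly_Mapping.keys ?k. (\<Prod>j\<in>Poly_Mapping.keys ?n. 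
        ?G i j ^ Poly_Mapping.lookup ?n j) ^ Poly_Mapping.lookup ?k i)"
    by (simp add: prod_power_distrib power_mult[symmetric] mult_ac)
  also have "\<dots> = (\<Prod>i\<in>I. \<Prod>j\<in>J. ?G (h i) (h' j))"
    by (simp only: prod_keys_sum_single[OF assms(1)] prod_keys_sum_single[OF assms(2)])
  finally show ?thesis .
qed

lemma funpow_map_prod:
  fixes \<sigma> :: "'a \<Rightarrow> 'a" and \<tau> :: "'b \<Rightarrow> 'b"
  shows "(map_prod \<sigma> \<tau> ^^ k) = map_prod (\<sigma> ^^ k) (\<tau> ^^ k)"
proof (induction k)
  case (Suc k)
  show ?case by (simp add: Suc.IH fun_eq_iff)
qed (simp add: map_prod.id id_def)

text \<open>A pair of points of periods \<open>i\<close> and \<open>j\<close> has period \<open>lcm i j\<close>, and a pair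
  of cycles spans \<open>i * j\<close> points, hence \<open>gcd i j\<close> cycles: this is the Wei--Xu product.\<close>

lemma cycle_type_map_prod:
  assumes A: "finite A" "bij_betw \<sigma> A A" and B: "finite B" "bij_betw \<tau> B B"
  shows "cycle_type (A \<times> B) (map_prod \<sigma> \<tau>) = cycle_type A \<sigma> \<otimes>\<^sub>W cycle_type B \<tau>"
proof -
  let ?\<rho> = "map_prod \<sigma> \<tau>"
  have \<rho>: "bij_betw ?\<rho> (A \<times> B) (A \<times> B)" using A(2) B(2) by (rule bij_betw_map_prod)
  have "cycle_type (A \<times> B) ?\<rho> = (\<Prod>i\<in>orbit \<sigma> ` A \<times> orbit \<tau> ` B.
      ct_var (lcm (card (fst i)) (card (snd i))) ^ gcd (card (fst i)) (card (snd i)))"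
  proof (rule cycle_type_eqI[where \<kappa> = "map_prod (orbit \<sigma>) (orbit \<tau>)"])
    fix i assume i: "i \<in> orbit \<sigma> ` A \<times> orbit \<tau> ` B"
    then show "lcm (card (fst i)) (card (snd i)) > 0"
      using card_orbit_pos[OF A] card_orbit_pos[OF B] by (auto simp: lcm_pos_nat)
    have "{x \<in> A \<times> B. map_prod (orbit \<sigma>) (orbit \<tau>) x = i} =
        {x \<in> A. orbit \<sigma> x = fst i} \<times> {x \<in> B. orbit \<tau> x = snd i}"
      by auto
    also have "\<dots> = fst i \<times> snd i"
      using i fibre_orbit[OF A, of "fst i"] fibre_orbit[OF B, of "snd i"] by (simp add: mem_Times_iff)
    finally show "card {x \<in> A \<times> B. map_prod (orbit \<sigma>) (orbit \<tau>) x = i} =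
        gcd (card (fst i)) (card (snd i)) * lcm (card (fst i)) (card (snd i))"
      by (simp only: card_cartesian_product prod_gcd_lcm_nat[symmetric])
  next
    fix x assume "x \<in> A \<times> B"
    then obtain y z where x: "x = (y, z)" "y \<in> A" "z \<in> B" by auto
    show "map_prod (orbit \<sigma>) (orbit \<tau>) (?\<rho> x) = map_prod (orbit \<sigma>) (orbit \<tau>) x"
      using x orbit_apply[OF A] orbit_apply[OF B] by simp
    show "card (orbit ?\<rho> x) = lcm (card (fst (map_prod (orbit \<sigma>) (orbit \<tau>) x)))
        (card (snd (map_prod (orbit \<sigma>) (orbit \<tau>) x)))"
    proof (rule card_orbit_eqI)
      show "x \<in> orbit ?\<rho> x"
        using self_in_orbit_finite_bij[OF _ \<rho>] A B x by auto
    qed (use x funpow_fixes_iff_card_orbit_dvd[OF self_in_orbit_finite_bij[OF A x(2)]]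
        funpow_fixes_iff_card_orbit_dvd[OF self_in_orbit_finite_bij[OF B x(3)]]
        in \<open>simp add: funpow_map_prod\<close>)
  qed (use A B \<rho> in auto)
  also have "\<dots> = cycle_type A \<sigma> \<otimes>\<^sub>W cycle_type B \<tau>"
    using A(1) B(1) unfolding cycle_type_eq_prod_orbits[OF A] cycle_type_eq_prod_orbits[OF B]
    by (simp add: wei_xu_prod_ct_var prod.cartesian_product case_prod_beta)
  finally show ?thesis .
qed

text \<open>The Kakutani tower of height \<open>N\<close> over \<open>\<sigma>\<close>: a point climbs through
  \<open>N\<close> copies of the base and is moved by \<open>\<sigma>\<close> when it returns to the ground floor.\<close>

definition tower :: "nat \<Rightarrow> ('a \<Rightarrow> 'a) \<Rightarrow> 'a \<times> nat \<Rightarrow> 'a \<times> nat" where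
  "tower N \<sigma> = (\<lambda>(x, s). if Suc s < N then (x, Suc s) else (\<sigma> x, 0))"

lemma funpow_tower:
  assumes "s < N"
  shows "(tower N \<sigma> ^^ k) (x, s) = ((\<sigma> ^^ ((s + k) div N)) x, (s + k) mod N)"
proof (induction k)
  case (Suc k)
  then show ?case
    using assms mod_less_divisor[of N "s + k"]
    by (auto simp: tower_def div_Suc mod_Suc simp del: mod_less_divisor)
qed (use assms in simp)

lemma bij_betw_tower:
  assumes "finite A" "bij_betw \<sigma> A A" "N > 0"
  shows "bij_betw (tower N \<sigma>) (A \<times> {..<N}) (A \<times> {..<N})"
proof -
  have inj: "inj_on (tower N \<sigma>) (A \<times> {..<N})"
    using assms(2) by (auto simp: inj_on_def tower_def bij_betw_def split: if_splits)
  have "tower N \<sigma> ` (A \<times> {..<N}) \<subseteq> A \<times> {..<N}"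
    using assms(2,3) by (auto simp: tower_def bij_betw_def split: if_splits)
  then have "tower N \<sigma> ` (A \<times> {..<N}) = A \<times> {..<N}"
    using inj assms(1) by (intro endo_inj_surj) auto
  with inj show ?thesis by (simp add: bij_betw_def)
qed

text \<open>A cycle of the tower lies over exactly one cycle of \<open>\<sigma>\<close> and passes \<open>N\<close> floors
  above each of its points, so the only effect is to multiply all cycle lengths by \<open>N\<close>.\<close>

lemma cycle_type_tower:
  assumes fin: "finite A" "bij_betw \<sigma> A A" and N: "N > 0"
  shows "cycle_type (A \<times> {..<N}) (tower N \<sigma>) = BU N (cycle_type A \<sigma>)"
proof -
  note T = bij_betw_tower[OF fin N]
  have "cycle_type (A \<times> {..<N}) (tower N \<sigma>) = (\<Prod>C\<in>orbit \<sigma> ` A. ct_var (N * card C) ^ 1)"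
  proof (rule cycle_type_eqI[where \<kappa> = "\<lambda>z. orbit \<sigma> (fst z)"])
    fix C assume C: "C \<in> orbit \<sigma> ` A"
    show "N * card C > 0" using C N card_orbit_pos[OF fin] by auto
    have "{z \<in> A \<times> {..<N}. orbit \<sigma> (fst z) = C} = {x \<in> A. orbit \<sigma> x = C} \<times> {..<N}" by auto
    then show "card {z \<in> A \<times> {..<N}. orbit \<sigma> (fst z) = C} = 1 * (N * card C)"
      using fibre_orbit[OF fin C] by (simp add: card_cartesian_product)
  next
    fix z assume "z \<in> A \<times> {..<N}"
    then obtain x s where z: "z = (x, s)" "x \<in> A" "s < N" by auto
    note self = self_in_orbit_finite_bij[OF fin z(2)]
    show "orbit \<sigma> (fst (tower N \<sigma> z)) = orbit \<sigma> (fst z)"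
      using z orbit_apply[OF fin z(2)] by (simp add: tower_def)
    show "card (orbit (tower N \<sigma>) z) = N * card (orbit \<sigma> (fst z))"
    proof (rule card_orbit_eqI)
      show "z \<in> orbit (tower N \<sigma>) z"
        using self_in_orbit_finite_bij[OF _ T] fin z by auto
      fix k
      have "(tower N \<sigma> ^^ k) z = z \<longleftrightarrow> (\<sigma> ^^ ((s + k) div N)) x = x \<and> (s + k) mod N = s"
        using z by (simp add: funpow_tower)
      also have "\<dots> \<longleftrightarrow> card (orbit \<sigma> x) dvd (s + k) div N \<and> (s + k) mod N = s mod N"
        using z funpow_fixes_iff_card_orbit_dvd[OF self] by simp
      also have "\<dots> \<longleftrightarrow> card (orbit \<sigma> x) dvd (s + k) div N \<and> N dvd k"
        using mod_eq_dvd_iff_nat[of s "s + k" N] by auto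
      also have "\<dots> \<longleftrightarrow> N * card (orbit \<sigma> x) dvd k"
      proof (cases "N dvd k")
        case True
        then obtain j where j: "k = N * j" by auto
        have "(s + k) div N = j" using z(3) N j by simp
        then show ?thesis using N j by simp
      next
        case False
        then show ?thesis using dvd_mult_left by blast
      qed
      finally show "(tower N \<sigma> ^^ k) z = z \<longleftrightarrow> N * card (orbit \<sigma> (fst z)) dvd k"
        using z by simp
    qed
  qed (use fin T in auto)
  then show ?thesis
    by (simp add: cycle_type_eq_prod_orbits[OF fin] BU_def ct_subst_prod ct_subst_var)
qed

section \<open>Affine maps modulo a polynomial over the field with two elements\<close>

text \<open>As a field, \<^typ>\<open>bit\<close> is a Euclidean ring in a trivial way. Making this known gives
  polynomials over \<^typ>\<open>bit\<close> unique factorization and the arithmetic of coprimality.\<close>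

instantiation bit ::
  "{unique_euclidean_ring, normalization_euclidean_semiring, normalization_semidom_multiplicative}"
begin

definition [simp]: "normalize_bit = (normalize_field :: bit \<Rightarrow> _)"
definition [simp]: "unit_factor_bit = (unit_factor_field :: bit \<Rightarrow> _)"
definition [simp]: "euclidean_size_bit = (euclidean_size_field :: bit \<Rightarrow> _)"
definition [simp]: "division_segment (x :: bit) = 1"

instance
  by standard
    (simp_all add: dvd_field_iff field_split_simps split: if_splits)

end

instantiation bit :: euclidean_ring_gcd
begin

definition gcd_bit :: "bit \<Rightarrow> bit \<Rightarrow> bit" where
  "gcd_bit = Euclidean_Algorithm.gcd"
definition lcm_bit :: "bit \<Rightarrow> bit \<Rightarrow> bit" where
  "lcm_bit = Euclidean_Algorithm.lcm"
definition Gcd_bit :: "bit set \<Rightarrow> bit" where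
  "Gcd_bit = Euclidean_Algorithm.Gcd"
definition Lcm_bit :: "bit set \<Rightarrow> bit" where
  "Lcm_bit = Euclidean_Algorithm.Lcm"

instance
  by standard (simp_all add: gcd_bit_def lcm_bit_def Gcd_bit_def Lcm_bit_def)

end

instance bit :: field_gcd ..

lemma bit_UNIV: "(UNIV :: bit set) = {0, 1}"
  by (auto simp: UNIV_eq_I)

lemma bit_poly_add_self: "p + p = 0" for p :: "bit poly"
proof (rule poly_eqI)
  have "a + a = 0" for a :: bit by (cases a) auto
  then show "coeff (p + p) i = coeff 0 i" for i by (simp only: coeff_add coeff_0)
qed

text \<open>Each further admissible degree doubles the number of polynomials: \<open>pCons\<close> prepends a free bit.\<close>

lemma card_bit_polys_below:
  "card {p :: bit poly. \<forall>i\<ge>d. coeff p i = 0} = 2 ^ d \<and>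
    finite {p :: bit poly. \<forall>i\<ge>d. coeff p i = 0}"
proof (induction d)
  case 0
  have "{p :: bit poly. \<forall>i\<ge>0. coeff p i = 0} = {0}" by (auto intro: poly_eqI)
  then show ?case by simp
next
  case (Suc d)
  let ?S = "\<lambda>d. {p :: bit poly. \<forall>i\<ge>d. coeff p i = 0}"
  have "?S (Suc d) = (\<lambda>(a, p). pCons a p) ` (UNIV \<times> ?S d)"
  proof (intro equalityI subsetI)
    fix p assume p: "p \<in> ?S (Suc d)"
    obtain a q where q: "p = pCons a q" by (cases p)
    have "coeff q i = 0" if "i \<ge> d" for i
      using p that q by (auto dest: spec[of _ "Suc i"])
    then show "p \<in> (\<lambda>(a, p). pCons a p) ` (UNIV \<times> ?S d)" using q by auto
  qed (auto simp: coeff_pCons split: nat.splits)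
  moreover have "inj_on (\<lambda>(a, p). pCons a p) (UNIV \<times> ?S d)" by (auto simp: inj_on_def)
  ultimately show ?case
    using Suc by (simp add: card_image card_cartesian_product bit_UNIV)
qed

text \<open>Computations in the quotient ring modulo \<open>P\<close> are done on the reduced representatives.\<close>

definition residues :: "bit poly \<Rightarrow> bit poly set" where
  "residues P = {R. R mod P = R}"

definition affine_mod :: "bit poly \<Rightarrow> bit poly \<Rightarrow> bit poly \<Rightarrow> bit poly \<Rightarrow> bit poly" where
  "affine_mod P U V R = (U * R + V) mod P"

lemma mod_in_residues [simp]: "R mod P \<in> residues P"
  by (simp add: residues_def)

lemma residues_eq:
  assumes "P \<noteq> 0"
  shows "residues P = {R. \<forall>i\<ge>degree P. coeff R i = 0}"
proof (intro equalityI subsetI)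
  fix R assume "R \<in> residues P"
  then have "R = 0 \<or> degree R < degree P"
    using degree_mod_less'[OF assms, of R] by (auto simp: residues_def)
  then show "R \<in> {R. \<forall>i\<ge>degree P. coeff R i = 0}" by (auto intro: coeff_eq_0)
next
  fix R :: "bit poly" assume R: "R \<in> {R. \<forall>i\<ge>degree P. coeff R i = 0}"
  have "R = 0 \<or> degree R < degree P"
    using R leading_coeff_neq_0[of R] by (auto simp: not_less[symmetric])
  then show "R \<in> residues P" by (auto simp: residues_def mod_poly_less)
qed

lemma finite_residues: "P \<noteq> 0 \<Longrightarrow> finite (residues P)"
  and card_residues: "P \<noteq> 0 \<Longrightarrow> card (residues P) = 2 ^ degree P"
  using card_bit_polys_below[of "degree P"] by (simp_all add: residues_eq)

lemma residues_eqI: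
  assumes "R \<in> residues P" "S \<in> residues P" "P dvd R - S"
  shows "R = S"
proof -
  have "R mod P = S mod P" using assms(3) by (simp only: mod_eq_dvd_iff)
  then show ?thesis using assms(1,2) by (simp only: residues_def mem_Collect_eq)
qed

lemma affine_mod_mod [simp]: "affine_mod P U V (R mod P) = (U * R + V) mod P"
  unfolding affine_mod_def by (rule mod_add_cong) (simp_all only: mod_mult_right_eq)

lemma affine_mod_in_residues [simp]: "affine_mod P U V R \<in> residues P"
  by (simp add: affine_mod_def)

text \<open>Injectivity is cancellation of the unit \<open>U\<close>; surjectivity comes for free because there
  are only finitely many residues.\<close>

lemma bij_betw_affine_mod:
  assumes "P \<noteq> 0" "coprime U P"
  shows "bij_betw (affine_mod P U V) (residues P) (residues P)"
proof -
  have inj: "inj_on (affine_mod P U V) (residues P)"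
  proof (rule inj_onI)
    fix R S assume RS: "R \<in> residues P" "S \<in> residues P" "affine_mod P U V R = affine_mod P U V S"
    then have "P dvd (U * R + V) - (U * S + V)" by (simp only: affine_mod_def mod_eq_dvd_iff)
    also have "(U * R + V) - (U * S + V) = U * (R - S)" by (simp add: algebra_simps)
    finally have "P dvd R - S" using assms(2) coprime_dvd_mult_right_iff[of P U] by (simp add: coprime_commute)
    then show "R = S" using residues_eqI RS by blast
  qed
  moreover have "affine_mod P U V ` residues P = residues P"
    using inj finite_residues[OF assms(1)] by (intro endo_inj_surj) auto
  ultimately show ?thesis by (simp add: bij_betw_def)
qed

lemma funpow_affine_mod:
  fixes R :: "bit poly"
  assumes "R \<in> residues P"
  shows "(affine_mod P U V ^^ k) R = (U ^ k * R + V * (\<Sum>i<k. U ^ i)) mod P"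
proof (induction k)
  case 0
  then show ?case using assms by (simp only: residues_def mem_Collect_eq funpow.simps id_apply) simp
next
  case (Suc k)
  have "(\<Sum>i<Suc k. U ^ i) = 1 + U * (\<Sum>i<k. U ^ i)"
    unfolding sum.lessThan_Suc_shift sum_distrib_left by simp
  then have "U ^ Suc k * R + V * (\<Sum>i<Suc k. U ^ i) = U * (U ^ k * R + V * (\<Sum>i<k. U ^ i)) + V"
    by (simp only: power_Suc ring_distribs mult_1_left mult_1_right mult_ac add_ac)
  then show ?case using Suc by (simp only: funpow.simps o_apply affine_mod_mod)
qed

lemma bij_betw_residue_class:
  "bij_betw (residue_class P) (residues P) (carrier (quot_ring P))"
  unfolding bij_betw_def
proof
  show "inj_on (residue_class P) (residues P)"
    by (rule inj_onI) (auto simp only: residue_class_eq_iff intro: residues_eqI)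
  have "residue_class P R = residue_class P (R mod P)" for R
    by (simp only: residue_class_eq_iff) (simp only: mod_eq_dvd_iff[symmetric] mod_mod_trivial)
  then show "residue_class P ` residues P = carrier (quot_ring P)"
    unfolding carrier_quot_ring using mod_in_residues by blast
qed

lemma residue_class_affine_mod: "residue_class P (affine_mod P U V R) = residue_class P (U * R + V)"
  by (simp only: residue_class_eq_iff mod_eq_dvd_iff[symmetric] affine_mod_def mod_mod_trivial)

lemma cycle_type_quot_ring:
  assumes "P \<noteq> 0" "coprime U P" "\<And>R. h (residue_class P R) = residue_class P (U * R + V)"
  shows "cycle_type (carrier (quot_ring P)) h = cycle_type (residues P) (affine_mod P U V)"
  using assms by (intro cycle_type_conj[OF _ _ bij_betw_residue_class])
    (auto simp: finite_residues bij_betw_affine_mod residue_class_affine_mod)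

lemma bij_betw_quot_ring:
  assumes "P \<noteq> 0" "coprime U P" "\<And>R. h (residue_class P R) = residue_class P (U * R + V)"
  shows "bij_betw h (carrier (quot_ring P)) (carrier (quot_ring P))"
proof -
  let ?\<phi> = "residue_class P" and ?C = "carrier (quot_ring P)"
  note bij = bij_betw_residue_class[of P]
  have "bij_betw (?\<phi> \<circ> affine_mod P U V \<circ> inv_into (residues P) ?\<phi>) ?C ?C"
    by (intro bij_betw_trans[of _ _ "residues P"] bij_betw_inv_into bij bij_betw_affine_mod assms)
  moreover have "h C = (?\<phi> \<circ> affine_mod P U V \<circ> inv_into (residues P) ?\<phi>) C" if "C \<in> ?C" for C
  proof -
    have C: "?\<phi> (inv_into (residues P) ?\<phi> C) = C"
      using bij that by (auto simp: bij_betw_def f_inv_into_f)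
    have "h C = h (?\<phi> (inv_into (residues P) ?\<phi> C))" by (simp only: C)
    then show ?thesis by (simp only: assms(3) residue_class_affine_mod o_apply)
  qed
  ultimately show ?thesis by (subst bij_betw_cong)
qed

text \<open>By the Chinese remainder theorem, an affine map modulo a product of coprime polynomials is the
  product of its reductions. That the remainders determine a residue is seen from divisibility, that
  all pairs occur from counting.\<close>

lemma cycle_type_affine_mod_mult:
  assumes "P1 \<noteq> 0" "P2 \<noteq> 0" "coprime P1 P2" "coprime U P1" "coprime U P2"
  shows "cycle_type (residues (P1 * P2)) (affine_mod (P1 * P2) U V) =
    cycle_type (residues P1) (affine_mod P1 U V) \<otimes>\<^sub>W cycle_type (residues P2) (affine_mod P2 U V)"
proof -
  let ?\<phi> = "\<lambda>R. (R mod P1, R mod P2)" and ?P = "P1 * P2"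
  have P: "?P \<noteq> 0" "coprime U ?P" using assms by auto
  have inj: "inj_on ?\<phi> (residues ?P)"
  proof (rule inj_onI)
    fix R S assume RS: "R \<in> residues ?P" "S \<in> residues ?P" "?\<phi> R = ?\<phi> S"
    then have "P1 dvd R - S" "P2 dvd R - S" by (simp_all only: prod.inject mod_eq_dvd_iff)
    then have "?P dvd R - S" using assms(3) by (rule divides_mult)
    then show "R = S" using residues_eqI RS by blast
  qed
  have "?\<phi> ` residues ?P = residues P1 \<times> residues P2"
  proof (rule card_subset_eq)
    show "card (?\<phi> ` residues ?P) = card (residues P1 \<times> residues P2)"
      using assms P by (simp add: card_image[OF inj] card_cartesian_product card_residues
          degree_mult_eq power_add)
  qed (use assms in \<open>auto simp: finite_residues\<close>)
  with inj have bij: "bij_betw ?\<phi> (residues ?P) (residues P1 \<times> residues P2)"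
    by (simp add: bij_betw_def)
  have "cycle_type (residues P1 \<times> residues P2) (map_prod (affine_mod P1 U V) (affine_mod P2 U V)) =
      cycle_type (residues ?P) (affine_mod ?P U V)"
    using assms P by (intro cycle_type_conj[OF _ _ bij])
      (auto simp: finite_residues bij_betw_affine_mod affine_mod_def[of ?P] mod_mod_cancel)
  then show ?thesis
    using assms by (simp add: cycle_type_map_prod finite_residues bij_betw_affine_mod)
qed

text \<open>If \<open>U - 1\<close> is a unit, then \<open>U * S + V = S\<close> can be solved for \<open>S\<close>; moving
  the origin to this fixed point removes the translation part.\<close>

lemma cycle_type_affine_mod_translate:
  assumes "P \<noteq> 0" "coprime U P" "coprime (U - 1) P"
  shows "cycle_type (residues P) (affine_mod P U V) = cycle_type (residues P) (affine_mod P U 0)"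
proof -
  have "bij_betw (affine_mod P (U - 1) V) (residues P) (residues P)"
    using assms(1,3) by (rule bij_betw_affine_mod)
  \<comment> \<open>The fixed point is a zero of another affine bijection.\<close>
  then obtain S where S: "affine_mod P (U - 1) V S = 0"
    by (metis bij_betw_imp_surj_on imageE mod_0 mod_in_residues)
  then have dvd: "P dvd (U - 1) * S + V" by (simp only: affine_mod_def dvd_eq_mod_eq_0)
  show ?thesis
  proof (rule cycle_type_conj)
    show "bij_betw (affine_mod P 1 S) (residues P) (residues P)"
      using assms(1) by (intro bij_betw_affine_mod) auto
    show "affine_mod P 1 S (affine_mod P U 0 R) = affine_mod P U V (affine_mod P 1 S R)" for R
    proof -
      have "affine_mod P 1 S (affine_mod P U 0 R) = (U * R + S) mod P" by (simp add: affine_mod_def[of P U 0])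
      also have "\<dots> = (U * (R + S) + V) mod P"
      proof -
        have "(U * (R + S) + V) - (U * R + S) = (U - 1) * S + V"
          by (simp add: algebra_simps)
        then show ?thesis using dvd by (metis mod_eq_dvd_iff)
      qed
      also have "\<dots> = affine_mod P U V (affine_mod P 1 S R)" by (simp add: affine_mod_def[of P 1 S])
      finally show ?thesis .
    qed
  qed (use assms in \<open>auto simp: finite_residues bij_betw_affine_mod\<close>)
qed

lemma cycle_type_affine_mod_prod:
  assumes "\<And>i. i \<in> {1..r} \<Longrightarrow> F i \<noteq> 0" "\<And>i. i \<in> {1..r} \<Longrightarrow> coprime U (F i)"
    "\<And>i j. i \<in> {1..r} \<Longrightarrow> j \<in> {1..r} \<Longrightarrow> i \<noteq> j \<Longrightarrow> coprime (F i) (F j)"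
  shows "cycle_type (residues (\<Prod>i = 1..r. F i)) (affine_mod (\<Prod>i = 1..r. F i) U 0) =
    wei_xu_prod (\<lambda>i. cycle_type (residues (F i)) (affine_mod (F i) U 0)) r"
  using assms
proof (induction r)
  case 0
  \<comment> \<open>The empty product is \<open>1\<close>, and \<open>0\<close> is the only residue modulo \<open>1\<close>.\<close>
  have "cycle_type (residues 1) (affine_mod 1 U 0) = ct_var 1 ^ 1"
  proof (rule cycle_type_const_period)
    fix R assume "R \<in> residues 1"
    then have "R = 0" by (simp add: residues_def)
    moreover have "orbit (affine_mod 1 U 0) 0 = {0}" by (simp add: orbit_eq_singleton_iff affine_mod_def)
    ultimately show "card (orbit (affine_mod 1 U 0) R) = 1" by simp
  qed (auto simp: finite_residues bij_betw_affine_mod card_residues)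
  then show ?case by simp
next
  case (Suc r)
  have "cycle_type (residues ((\<Prod>i = 1..r. F i) * F (Suc r))) (affine_mod ((\<Prod>i = 1..r. F i) * F (Suc r)) U 0) =
    cycle_type (residues (\<Prod>i = 1..r. F i)) (affine_mod (\<Prod>i = 1..r. F i) U 0) \<otimes>\<^sub>W
    cycle_type (residues (F (Suc r))) (affine_mod (F (Suc r)) U 0)"
    using Suc.prems by (intro cycle_type_affine_mod_mult prod_coprime_left prod_coprime_right) auto
  then show ?case using Suc by simp
qed

section \<open>The part at \<open>X - 1\<close>\<close>

text \<open>The Frobenius endomorphism in characteristic two.\<close>

lemma bit_poly_one_add_power_two_power: "(1 + p) ^ 2 ^ k = 1 + p ^ 2 ^ k" for p :: "bit poly"
proof (induction k)
  case (Suc k)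
  let ?q = "p ^ 2 ^ k"
  have "(1 + p) ^ 2 ^ Suc k = (1 + ?q) * (1 + ?q)"
    by (simp only: power_Suc mult_2 power_add Suc.IH)
  also have "\<dots> = 1 + ?q * ?q + (?q + ?q)" by (simp only: ring_distribs mult_1_left mult_1_right add_ac)
  also have "\<dots> = 1 + p ^ 2 ^ Suc k" by (simp only: bit_poly_add_self power_Suc mult_2 power_add add_0_right)
  finally show ?case .
qed simp

text \<open>The geometric sum times \<open>y\<close> is \<open>(1 + y) ^ 2 ^ j - 1\<close>, which the Frobenius
  endomorphism turns into \<open>y ^ 2 ^ j\<close>.\<close>

lemma sum_one_add_powers:
  assumes "y \<noteq> (0 :: bit poly)"
  shows "(\<Sum>i<2 ^ j. (1 + y) ^ i) = y ^ (2 ^ j - 1)"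
proof -
  have "y * (\<Sum>i<2 ^ j. (1 + y) ^ i) = (1 + y) ^ 2 ^ j - 1"
    by (simp add: power_diff_1_eq)
  also have "\<dots> = y ^ 2 ^ j" by (simp add: bit_poly_one_add_power_two_power)
  also have "\<dots> = y * y ^ (2 ^ j - 1)" by (metis power_minus_mult mult.commute zero_less_numeral zero_less_power)
  finally show ?thesis using assms by simp
qed

text \<open>The iterates at powers of two are the ones with a simple displacement: \<open>R\<close> is moved by
  \<open>y ^ (2 ^ j - 1) * (y * R + V)\<close>. They suffice to find the period of a point, since
  modulo a power of \<open>y\<close> it is a power of two.\<close>

lemma funpow_affine_mod_two_power_eq_iff:
  assumes "R \<in> residues P" "y \<noteq> 0"
  shows "(affine_mod P (1 + y) V ^^ 2 ^ j) R = R \<longleftrightarrow> P dvd y ^ (2 ^ j - 1) * (y * R + V)"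
proof -
  have y: "y ^ 2 ^ j = y ^ (2 ^ j - 1) * y" by (rule power_minus_mult[symmetric]) simp
  have "(affine_mod P (1 + y) V ^^ 2 ^ j) R = R \<longleftrightarrow>
      ((1 + y ^ 2 ^ j) * R + V * y ^ (2 ^ j - 1)) mod P = R mod P"
    using assms by (simp add: funpow_affine_mod sum_one_add_powers bit_poly_one_add_power_two_power)
      (simp add: residues_def)
  also have "\<dots> \<longleftrightarrow> P dvd ((1 + y ^ 2 ^ j) * R + V * y ^ (2 ^ j - 1)) - R"
    by (rule mod_eq_dvd_iff)
  also have "((1 + y ^ 2 ^ j) * R + V * y ^ (2 ^ j - 1)) - R = y ^ (2 ^ j - 1) * (y * R + V)"
    unfolding y by (simp add: algebra_simps)
  finally show ?thesis .
qed

lemma card_orbit_eq_two_power: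
  assumes "x \<in> orbit \<sigma> x" "(\<sigma> ^^ 2 ^ l) x = x" "l > 0 \<Longrightarrow> (\<sigma> ^^ 2 ^ (l - 1)) x \<noteq> x"
  shows "card (orbit \<sigma> x) = 2 ^ l"
proof -
  note iff = funpow_fixes_iff_card_orbit_dvd[OF assms(1)]
  obtain i where i: "i \<le> l" "card (orbit \<sigma> x) = 2 ^ i"
    using assms(2) iff divides_primepow_nat[of 2 _ l] by auto
  have "i = l"
  proof (rule ccontr)
    assume "i \<noteq> l"
    then have "l > 0" "card (orbit \<sigma> x) dvd 2 ^ (l - 1)" using i by (auto intro: le_imp_power_dvd)
    then show False using assms(3) iff by simp
  qed
  then show ?thesis using i by simp
qed

text \<open>From here on, \<open>Y\<close> stands for \<open>X - 1\<close> and \<open>C\<close> for the translation part. The bound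
  on the degree of \<open>C\<close> keeps the multiplicity of \<open>Y\<close> in \<open>C\<close> below
  \<open>2 ^ n\<close>.\<close>

context
  fixes Y C :: "bit poly" and n :: nat
  assumes Y: "degree Y = 1" and C: "C \<noteq> 0" "degree C < 2 ^ n"
begin

lemma Y_power_not_dvd: "\<not> Y ^ 2 ^ n dvd C"
proof
  assume "Y ^ 2 ^ n dvd C"
  then have "degree (Y ^ 2 ^ n) \<le> degree C" using C by (intro dvd_imp_degree_le)
  then show False using Y C by (subst (asm) degree_power_eq) auto
qed

text \<open>As \<open>Y ^ N\<close> does not divide \<open>C\<close> for \<open>N = 2 ^ n\<close>, the multiplicity of
  \<open>Y\<close> in \<open>Y ^ N * R + C\<close> is smaller than \<open>N\<close> and is that of \<open>C\<close>, whatever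
  \<open>R\<close> may be. The displacement contributes another \<open>N * (2 ^ j - 1)\<close> factors, to be
  compared with \<open>a * N + b\<close>: the multiples of \<open>N\<close> decide, except for a tie, in which the
  remaining \<open>b\<close> factors have to come from \<open>C\<close>. In particular, all points have the
  same period.\<close>

lemma unipotent_return_iff:
  assumes "R \<in> residues (Y ^ (a * 2 ^ n + b))" "b < 2 ^ n"
  shows "(affine_mod (Y ^ (a * 2 ^ n + b)) (1 + Y ^ 2 ^ n) C ^^ 2 ^ j) R = R \<longleftrightarrow>
    a + 1 < 2 ^ j \<or> a + 1 = 2 ^ j \<and> Y ^ b dvd C"
proof -
  let ?N = "2 ^ n :: nat" and ?Z = "Y ^ 2 ^ n * R + C"
  have Y0: "Y \<noteq> 0" using Y by auto
  have iff: "(affine_mod (Y ^ (a * ?N + b)) (1 + Y ^ ?N) C ^^ 2 ^ j) R = R \<longleftrightarrow>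
      Y ^ (a * ?N + b) dvd Y ^ (?N * (2 ^ j - 1)) * ?Z"
    using funpow_affine_mod_two_power_eq_iff[OF assms(1), where y = "Y ^ ?N" and V = C and j = j] Y0 by (simp add: power_mult)
  have Z: "Y ^ k dvd ?Z \<longleftrightarrow> Y ^ k dvd C" if "k \<le> ?N" for k
    by (rule dvd_add_right_iff) (intro dvd_mult2 le_imp_power_dvd that)
  consider "a + 1 < 2 ^ j" | "a + 1 = 2 ^ j" | "2 ^ j < a + 1" by linarith
  then show ?thesis
  proof cases
    case 1
    have "(a + 1) * ?N \<le> (2 ^ j - 1) * ?N" using 1 by (intro mult_right_mono) auto
    then have "a * ?N + b \<le> ?N * (2 ^ j - 1)" using assms(2) by (simp add: mult.commute)
    then have "Y ^ (a * ?N + b) dvd Y ^ (?N * (2 ^ j - 1)) * ?Z"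
      by (intro dvd_mult2 le_imp_power_dvd)
    then show ?thesis using iff 1 by simp
  next
    case 2
    have eq: "?N * (2 ^ j - 1) = a * ?N" unfolding 2[symmetric] by simp
    have "Y ^ (a * ?N + b) dvd Y ^ (?N * (2 ^ j - 1)) * ?Z \<longleftrightarrow>
        Y ^ (a * ?N) * Y ^ b dvd Y ^ (a * ?N) * ?Z"
      unfolding eq power_add ..
    also have "\<dots> \<longleftrightarrow> Y ^ b dvd C" using Y0 Z assms(2) by simp
    finally show ?thesis using iff 2 by simp
  next
    case 3
    have "\<not> Y ^ (a * ?N + b) dvd Y ^ (?N * (2 ^ j - 1)) * ?Z"
    proof
      assume dvd: "Y ^ (a * ?N + b) dvd Y ^ (?N * (2 ^ j - 1)) * ?Z"
      have "(2 ^ j - 1 + 1) * ?N \<le> a * ?N" using 3 by (intro mult_right_mono) auto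
      then have "?N * (2 ^ j - 1) + ?N \<le> a * ?N + b"
        by (simp only: add_mult_distrib mult_1_left mult.commute[of ?N])
      then have "Y ^ (?N * (2 ^ j - 1)) * Y ^ ?N dvd Y ^ (a * ?N + b)"
        unfolding power_add[symmetric] by (rule le_imp_power_dvd)
      then have "Y ^ (?N * (2 ^ j - 1)) * Y ^ ?N dvd Y ^ (?N * (2 ^ j - 1)) * ?Z"
        using dvd by (rule dvd_trans)
      then have "Y ^ ?N dvd ?Z" using Y0 by simp
      then show False using Z Y_power_not_dvd by simp
    qed
    then show ?thesis using iff 3 by simp
  qed
qed

lemma coprime_one_add_power: "coprime (1 + Y ^ 2 ^ n) (Y ^ e)"
proof -
  have "coprime (1 + Y ^ 2 ^ n) Y"
  proof (rule coprimeI)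
    fix D assume D: "D dvd 1 + Y ^ 2 ^ n" "D dvd Y"
    then have "D dvd Y ^ 2 ^ n" by (meson dvd_power dvd_trans zero_less_numeral zero_less_power)
    then show "D dvd 1" using D(1) dvd_add_left_iff by blast
  qed
  then show ?thesis by simp
qed

lemma cycle_type_unipotent_two_power:
  assumes e: "e = a * 2 ^ n + b" "b < 2 ^ n" and l: "l \<le> e"
    and ret: "a + 1 < 2 ^ l \<or> a + 1 = 2 ^ l \<and> Y ^ b dvd C"
    and nret: "l > 0 \<Longrightarrow> \<not> (a + 1 < 2 ^ (l - 1) \<or> a + 1 = 2 ^ (l - 1) \<and> Y ^ b dvd C)"
  shows "cycle_type (residues (Y ^ e)) (affine_mod (Y ^ e) (1 + Y ^ 2 ^ n) C) = ct_var (2 ^ l) ^ 2 ^ (e - l)"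
proof (rule cycle_type_const_period)
  have Y0: "Y ^ e \<noteq> 0" using Y by auto
  show fin: "finite (residues (Y ^ e))" using Y0 by (rule finite_residues)
  show bij: "bij_betw (affine_mod (Y ^ e) (1 + Y ^ 2 ^ n) C) (residues (Y ^ e)) (residues (Y ^ e))"
    using Y0 coprime_one_add_power by (rule bij_betw_affine_mod)
  have "Y \<noteq> 0" using Y by auto
  then have "card (residues (Y ^ e)) = 2 ^ e" using Y by (simp add: card_residues degree_power_eq)
  also have "\<dots> = 2 ^ (e - l) * 2 ^ l" using l by (simp add: power_add[symmetric])
  finally show "card (residues (Y ^ e)) = 2 ^ (e - l) * 2 ^ l" .
  show "card (orbit (affine_mod (Y ^ e) (1 + Y ^ 2 ^ n) C) R) = 2 ^ l" if R: "R \<in> residues (Y ^ e)" for R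
    using self_in_orbit_finite_bij[OF fin bij R] unipotent_return_iff[OF R[unfolded e(1)] e(2)] ret nret
    by (intro card_orbit_eq_two_power) (simp_all add: e(1))
qed simp

end

lemma ceiling_log2_le_iff:
  assumes "e > 0"
  shows "\<lceil>log 2 (real e)\<rceil> \<le> int n \<longleftrightarrow> e \<le> 2 ^ n"
proof -
  have "\<lceil>log 2 (real e)\<rceil> \<le> int n \<longleftrightarrow> real e \<le> 2 powr real n"
    using assms by (simp add: ceiling_le_iff log_le_iff)
  also have "\<dots> \<longleftrightarrow> e \<le> 2 ^ n" by (simp add: powr_realpow)
  finally show ?thesis .
qed

lemma log2_Suc_in_Ints_iff: "log 2 (real a + 1) \<in> \<int> \<longleftrightarrow> (\<exists>l. a + 1 = 2 ^ l)"
proof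
  assume "log 2 (real a + 1) \<in> \<int>"
  then obtain z where z: "log 2 (real a + 1) = of_int z" by (auto elim: Ints_cases)
  have "z \<ge> 0" using z zero_le_log_cancel_iff[of 2 "real a + 1"] by simp
  then have "log 2 (real a + 1) = real (nat z)" using z by simp
  then have "real a + 1 = 2 powr real (nat z)"
    using powr_log_cancel[of 2 "real a + 1"] by simp
  then have "real (a + 1) = real (2 ^ nat z)" by (simp add: powr_realpow)
  then show "\<exists>l. a + 1 = 2 ^ l" by (simp only: of_nat_eq_iff) blast
next
  assume "\<exists>l. a + 1 = 2 ^ l"
  then obtain l where "a + 1 = 2 ^ l" by blast
  then have "real a + 1 = 2 ^ l" by (metis of_nat_1 of_nat_add of_nat_numeral of_nat_power)
  then show "log 2 (real a + 1) \<in> \<int>" by (simp add: log_nat_power)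
qed

lemma floor_log2_bounds:
  assumes "a > 0"
  defines "k \<equiv> nat \<lfloor>log 2 (real a)\<rfloor>"
  shows "2 ^ k \<le> a" "a < 2 ^ (k + 1)"
proof -
  have "\<lfloor>log 2 (real a)\<rfloor> = int k" using assms by simp
  then have "2 powr real k \<le> real a \<and> real a < 2 powr real (k + 1)"
    using assms(1) by (simp add: floor_log_eq_powr_iff add.commute)
  then have "real (2 ^ k) \<le> real a \<and> real a < real (2 ^ (k + 1))"
    by (simp only: powr_realpow zero_less_numeral of_nat_power of_nat_numeral)
  then show "2 ^ k \<le> a" "a < 2 ^ (k + 1)" by (simp_all only: of_nat_le_iff of_nat_less_iff)
qed

text \<open>Only the exponent \<open>l\<close> of the common period remains to be read off from the comparison of
  \<open>a + 1\<close> with the powers of two, and the three conditions with logarithms to be restated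
  in these terms.\<close>

lemma cycle_type_unipotent:
  fixes Y C :: "bit poly"
  assumes Y: "degree Y = 1" and C: "C \<noteq> 0" "degree C < 2 ^ n" and n: "n > 0"
    and e: "e = a * 2 ^ n + b" "b < 2 ^ n"
  shows "cycle_type (residues (Y ^ e)) (affine_mod (Y ^ e) (1 + Y ^ 2 ^ n) C) =
    (if e = 0 then ct_var 1
     else if int n \<ge> \<lceil>log 2 (real e)\<rceil> then
       (if Y ^ e dvd C then ct_var 1 ^ (2 ^ e) else ct_var 2 ^ (2 ^ (e - 1)))
     else if log 2 (real a + 1) \<notin> \<int> then
       ct_var (2 ^ (nat \<lfloor>log 2 (real a)\<rfloor> + 1)) ^ (2 ^ (e - nat \<lfloor>log 2 (real a)\<rfloor> - 1))
     else if Y ^ b dvd C then ct_var (a + 1) ^ (2 ^ e div (a + 1))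
     else ct_var (2 * a + 2) ^ (2 ^ (e - 1) div (a + 1)))"
proof -
  note ct = cycle_type_unipotent_two_power[OF Y C e]
  have N: "2 \<le> (2 :: nat) ^ n" using n by (metis one_le_numeral power_increasing power_one_right Suc_leI One_nat_def)
  \<comment> \<open>This bound gives \<open>l \<le> e\<close> in each case, so that a cycle fits into the residues.\<close>
  have e2: "2 * a \<le> e" using e(1) mult_le_mono2[OF N, of a] by linarith
  consider "e = 0" | "e > 0" "e \<le> 2 ^ n" | "2 ^ n < e" by linarith
  then show ?thesis
  proof cases
    case 1
    then have "a = 0" "b = 0" using e by auto
    then show ?thesis using ct[of 0] 1 by simp
  next
    case 2
    have "cycle_type (residues (Y ^ e)) (affine_mod (Y ^ e) (1 + Y ^ 2 ^ n) C) =
      (if Y ^ e dvd C then ct_var 1 ^ (2 ^ e) else ct_var 2 ^ (2 ^ (e - 1)))"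
    proof (cases "e = 2 ^ n")
      case True
      \<comment> \<open>The condition on the logarithm of \<open>e\<close> includes this boundary case, which has \<open>a = 1\<close>.\<close>
      have "a = 1 \<and> b = 0"
      proof -
        have "a = e div 2 ^ n" "b = e mod 2 ^ n" using e by auto
        then show ?thesis using True by simp
      qed
      then show ?thesis
        using ct[of 1] True Y_power_not_dvd[OF Y C] 2 by simp
    next
      case False
      have "a = 0 \<and> b = e"
      proof -
        have "a = e div 2 ^ n" "b = e mod 2 ^ n" using e by auto
        then show ?thesis using False 2 by simp
      qed
      then show ?thesis using ct[of 0] ct[of 1] 2 by auto
    qed
    then show ?thesis using 2 ceiling_log2_le_iff[of e n] by simp
  next
    case 3
    then have e0: "e > 0" and nle: "\<not> \<lceil>log 2 (real e)\<rceil> \<le> int n"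
      using ceiling_log2_le_iff[of e n] by auto
    have a: "a > 0" using 3 e by (cases a) auto
    show ?thesis
    proof (cases "\<exists>l. a + 1 = 2 ^ l")
      case False
      let ?k = "nat \<lfloor>log 2 (real a)\<rfloor>"
      note k = floor_log2_bounds[OF a]
      \<comment> \<open>Here \<open>2 ^ k \<le> a < 2 ^ (k + 1)\<close>. As \<open>a + 1\<close> is not a power of two, also \<open>a + 1 < 2 ^ (k + 1)\<close>.\<close>
      have "?k < 2 ^ ?k" by (rule less_exp)
      then have "?k + 1 \<le> e" using k(1) e2 a by linarith
      moreover have "a + 1 < 2 ^ (?k + 1)"
        using k(2) False by (metis Suc_eq_plus1 Suc_leI nat_less_le)
      moreover have "\<not> (a + 1 < 2 ^ ?k \<or> a + 1 = 2 ^ ?k)" using k(1) by simp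
      ultimately have "cycle_type (residues (Y ^ e)) (affine_mod (Y ^ e) (1 + Y ^ 2 ^ n) C) =
          ct_var (2 ^ (?k + 1)) ^ (2 ^ (e - (?k + 1)))"
        by (intro ct) auto
      then show ?thesis using False e0 nle by (simp only: log2_Suc_in_Ints_iff) simp
    next
      case True
      then obtain l where l: "a + 1 = 2 ^ l" by blast
      have "l < 2 ^ l" by (rule less_exp)
      then have le: "l + 1 \<le> e" using l e2 a by linarith
      have div: "2 ^ e div (a + 1) = 2 ^ (e - l)" "2 ^ (e - 1) div (a + 1) = 2 ^ (e - (l + 1))"
        unfolding l using le power_diff[of "2 :: nat" l e] power_diff[of "2 :: nat" l "e - 1"] by simp_all
      have l2: "2 * a + 2 = 2 ^ (l + 1)" using l by simp
      have "l > 0" using l a by (cases l) auto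
      then have "\<not> (a + 1 < 2 ^ (l - 1) \<or> a + 1 = 2 ^ (l - 1))" unfolding l by auto
      then have "cycle_type (residues (Y ^ e)) (affine_mod (Y ^ e) (1 + Y ^ 2 ^ n) C) =
          (if Y ^ b dvd C then ct_var (a + 1) ^ (2 ^ e div (a + 1))
           else ct_var (2 * a + 2) ^ (2 ^ (e - 1) div (a + 1)))"
        using ct[of l] ct[of "l + 1"] le unfolding div unfolding l l2 by auto
      then show ?thesis using True e0 nle by (simp only: log2_Suc_in_Ints_iff) simp
    qed
  qed
qed

section \<open>Polynomials in a linear map\<close>

text \<open>The value of the polynomial \<open>R\<close> at the endomorphism \<open>g\<close>, applied to \<open>v\<close>. The
  form is Horner's, because feeding one more bit into a register is one step of Horner's scheme.\<close>

definition poly_act :: "nat \<Rightarrow> ('a :: field vec \<Rightarrow> 'a vec) \<Rightarrow> 'a poly \<Rightarrow> 'a vec \<Rightarrow> 'a vec" where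
  "poly_act m g R v = fold_coeffs (\<lambda>a w. a \<cdot>\<^sub>v v + g w) R (0\<^sub>v m)"

lemma add_vec_swap_middle:
  fixes a b c d :: "'a :: comm_ring vec"
  assumes "a \<in> carrier_vec m" "b \<in> carrier_vec m" "c \<in> carrier_vec m" "d \<in> carrier_vec m"
  shows "(a + b) + (c + d) = (a + c) + (b + d)"
  using assms by (intro eq_vecI) (auto simp: carrier_vecD algebra_simps)

lemma smult_zero_vec: "c \<cdot>\<^sub>v 0\<^sub>v m = (0\<^sub>v m :: 'a :: ring vec)"
  by (intro eq_vecI) auto

lemma zero_smult_vec: "v \<in> carrier_vec m \<Longrightarrow> 0 \<cdot>\<^sub>v v = (0\<^sub>v m :: 'a :: ring vec)"
  by (intro eq_vecI) auto

context
  fixes m :: nat and g :: "'a :: field vec \<Rightarrow> 'a vec"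
  assumes linear: "linear_map class_ring (module_vec TYPE('a) m) (module_vec TYPE('a) m) g"
begin

interpretation lin: linear_map class_ring "module_vec TYPE('a) m" "module_vec TYPE('a) m" g
  by (rule linear)

lemma lin_carrier [simp]: "v \<in> carrier_vec m \<Longrightarrow> g v \<in> carrier_vec m"
  using lin.f_im[of v] by (simp add: module_vec_simps)

lemma lin_add: "v \<in> carrier_vec m \<Longrightarrow> w \<in> carrier_vec m \<Longrightarrow> g (v + w) = g v + g w"
  using lin.f_add[of v w] by (simp add: module_vec_simps)

lemma lin_smult: "v \<in> carrier_vec m \<Longrightarrow> g (a \<cdot>\<^sub>v v) = a \<cdot>\<^sub>v g v"
  using lin.f_smult[of a v] by (simp add: module_vec_simps class_ring_simps)

lemma lin_zero: "g (0\<^sub>v m) = 0\<^sub>v m"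
  using lin_smult[of "0\<^sub>v m" 0] by (simp add: zero_smult_vec[of _ m])

lemma poly_act_0 [simp]: "poly_act m g 0 v = 0\<^sub>v m"
  by (simp add: poly_act_def)

lemma poly_act_pCons:
  assumes "v \<in> carrier_vec m"
  shows "poly_act m g (pCons a R) v = a \<cdot>\<^sub>v v + g (poly_act m g R v)"
proof (cases "a = 0 \<and> R = 0")
  case True
  then show ?thesis using assms by (simp add: lin_zero zero_smult_vec[of _ m])
next
  case False
  then show ?thesis by (auto simp: poly_act_def)
qed

lemma poly_act_carrier [simp]:
  assumes "v \<in> carrier_vec m"
  shows "poly_act m g R v \<in> carrier_vec m"
  by (induction R) (simp_all add: assms poly_act_pCons)

lemma poly_act_add:
  assumes v: "v \<in> carrier_vec m"
  shows "poly_act m g (R + S) v = poly_act m g R v + poly_act m g S v"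
proof (induction R S rule: poly_induct2)
  case (pCons a R b S)
  have "poly_act m g (pCons a R + pCons b S) v =
      (a + b) \<cdot>\<^sub>v v + (g (poly_act m g R v) + g (poly_act m g S v))"
    using v pCons by (simp add: poly_act_pCons lin_add)
  also have "\<dots> = (a \<cdot>\<^sub>v v + g (poly_act m g R v)) + (b \<cdot>\<^sub>v v + g (poly_act m g S v))"
    unfolding add_smult_distrib_vec by (rule add_vec_swap_middle[of _ m]) (use v in simp_all)
  finally show ?case using v by (simp add: poly_act_pCons)
qed simp

lemma poly_act_smult:
  assumes v: "v \<in> carrier_vec m"
  shows "poly_act m g (Polynomial.smult c R) v = c \<cdot>\<^sub>v poly_act m g R v"
proof (induction R)
  case (pCons a R)
  then show ?case
    using v by (simp add: poly_act_pCons lin_smult smult_add_distrib_vec[of _ m] smult_smult_assoc)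
qed (simp add: smult_zero_vec)

lemma poly_act_mult:
  assumes v: "v \<in> carrier_vec m"
  shows "poly_act m g (R * S) v = poly_act m g R (poly_act m g S v)"
proof (induction R)
  case (pCons a R)
  have "poly_act m g (pCons a R * S) v = a \<cdot>\<^sub>v poly_act m g S v + (0 \<cdot>\<^sub>v v + g (poly_act m g (R * S) v))"
    using v by (simp add: mult_pCons_left poly_act_add poly_act_smult poly_act_pCons)
  also have "0 \<cdot>\<^sub>v v + g (poly_act m g (R * S) v) = g (poly_act m g (R * S) v)"
    using v by (simp add: zero_smult_vec[of _ m])
  finally show ?case using v pCons by (simp add: poly_act_pCons)
qed simp

lemma poly_act_zero_vec: "poly_act m g R (0\<^sub>v m) = 0\<^sub>v m"
  by (induction R) (simp_all add: poly_act_pCons lin_zero smult_zero_vec)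

lemma poly_act_add_vec:
  assumes v: "v \<in> carrier_vec m" "w \<in> carrier_vec m"
  shows "poly_act m g R (v + w) = poly_act m g R v + poly_act m g R w"
proof (induction R)
  case (pCons a R)
  have "poly_act m g (pCons a R) (v + w) =
      a \<cdot>\<^sub>v (v + w) + (g (poly_act m g R v) + g (poly_act m g R w))"
    using v pCons by (simp add: poly_act_pCons lin_add)
  also have "\<dots> = (a \<cdot>\<^sub>v v + g (poly_act m g R v)) + (a \<cdot>\<^sub>v w + g (poly_act m g R w))"
    unfolding smult_add_distrib_vec[OF v] by (rule add_vec_swap_middle[of _ m]) (use v in simp_all)
  finally show ?case using v by (simp add: poly_act_pCons)
qed simp

lemma poly_act_smult_vec:
  assumes v: "v \<in> carrier_vec m"
  shows "poly_act m g R (c \<cdot>\<^sub>v v) = c \<cdot>\<^sub>v poly_act m g R v"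
  using poly_act_mult[OF v, of R "[:c:]"] poly_act_mult[OF v, of "[:c:]" R] v
  by (simp add: poly_act_pCons lin_zero mult.commute)

lemma poly_act_monom:
  assumes v: "v \<in> carrier_vec m"
  shows "poly_act m g (monom a i) v = a \<cdot>\<^sub>v (g ^^ i) v \<and> (g ^^ i) v \<in> carrier_vec m"
proof (induction i)
  case (Suc i)
  then show ?case using v by (simp add: monom_Suc poly_act_pCons lin_smult zero_smult_vec[of _ m])
qed (use v in \<open>simp add: monom_0 poly_act_pCons lin_zero\<close>)

lemma poly_act_sum_index:
  assumes "v \<in> carrier_vec m" "k < m" "finite I"
  shows "poly_act m g (sum p I) v $ k = (\<Sum>i\<in>I. poly_act m g (p i) v $ k)"
  using assms(3)
proof induction
  case (insert i I)
  then show ?case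
    using assms(1,2) by (simp add: poly_act_add index_add_vec(1) carrier_vecD[OF poly_act_carrier])
qed (use assms in simp)

lemma poly_act_index:
  assumes v: "v \<in> carrier_vec m" "k < m"
  shows "poly_act m g (\<Sum>i\<in>I. monom (c i) (h i)) v $ k = (\<Sum>i\<in>I. c i * (g ^^ h i) v $ k)"
proof (cases "finite I")
  case True
  show ?thesis
    unfolding poly_act_sum_index[OF v True]
    using poly_act_monom[OF v(1)] v(2)
    by (intro sum.cong refl) (metis carrier_vecD index_smult_vec(1))
qed (use v in simp)

text \<open>For the basis \<open>b\<^sub>0, b\<^sub>1, \<dots>\<close> that represents \<open>g\<close>, all columns of the companion
  matrix but the last say \<open>b\<^sub>j = g\<^sup>j b\<^sub>0\<close>, and the last one then says that \<open>P\<close> annihilates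
  \<open>b\<^sub>0\<close>. As \<open>P\<close> evaluated at \<open>g\<close> commutes with \<open>g\<close>, it annihilates the whole basis.\<close>

lemma companion_annihilates:
  assumes P: "lead_coeff P = 1" "degree P = m" and m: "m > 0"
    and rep: "represented_by m g (companion_mat P)" and v: "v \<in> carrier_vec m"
  shows "poly_act m g P v = 0\<^sub>v m"
proof -
  let ?V = "module_vec TYPE('a) m"
  obtain bs where len: "length bs = m" and basis: "lin.V.basis (set bs)"
    and im: "\<And>j. j < m \<Longrightarrow> g (bs ! j) = mat_of_cols m bs *\<^sub>v col (companion_mat P) j"
    using rep unfolding represented_by_def by blast
  have bs: "bs ! j \<in> carrier_vec m" if "j < m" for j
    using basis that len unfolding lin.V.basis_def by (metis module_vec_simps(3) nth_mem subsetD)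
  define w where "w = bs ! 0"
  have w: "w \<in> carrier_vec m" using bs m by (simp add: w_def)
  have coord: "g (bs ! j) $ k = (\<Sum>i<m. companion_mat P $$ (i, j) * bs ! i $ k)" if "j < m" "k < m" for j k
    using that im[OF that(1)] len bs P
    by (simp add: companion_mat_def scalar_prod_def mat_of_cols_def lessThan_atLeast0 mult.commute)
  have shift: "g (bs ! j) = bs ! (j + 1)" if "j + 1 < m" for j
  proof (rule eq_vecI)
    show "dim_vec (g (bs ! j)) = dim_vec (bs ! (j + 1))"
      using that bs[of j] bs[of "j + 1"] by (simp add: carrier_vecD[OF lin_carrier])
    fix k assume "k < dim_vec (bs ! (j + 1))"
    then have k: "k < m" using that bs[of "j + 1"] by auto
    have "g (bs ! j) $ k = (\<Sum>i<m. (if i = j + 1 then 1 else 0) * bs ! i $ k)"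
      using that P unfolding coord[OF add_lessD1[OF that] k]
      by (intro sum.cong) (auto simp: companion_mat_def)
    also have "\<dots> = (\<Sum>i<m. if i = j + 1 then bs ! i $ k else 0)"
      by (intro sum.cong) auto
    also have "\<dots> = bs ! (j + 1) $ k" using that by simp
    finally show "g (bs ! j) $ k = bs ! (j + 1) $ k" .
  qed
  have pow: "j < m \<Longrightarrow> (g ^^ j) w = bs ! j" for j
    by (induction j) (use shift in \<open>simp_all add: w_def\<close>)
  have Pw: "poly_act m g P w = 0\<^sub>v m"
  proof (rule eq_vecI)
    fix k assume "k < dim_vec (0\<^sub>v m)"
    then have k: "k < m" by simp
    have "poly_act m g P w $ k = (\<Sum>i\<le>m. coeff P i * (g ^^ i) w $ k)"
      using poly_act_index[OF w k, of "coeff P" "\<lambda>i. i" "{..m}"] poly_as_sum_of_monoms[of P] P(2)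
      by simp
    also have "\<dots> = (\<Sum>i<m. coeff P i * bs ! i $ k) + (g ^^ m) w $ k"
      using pow P by (simp add: lessThan_Suc_atMost[symmetric])
    also have "(g ^^ m) w = g (bs ! (m - 1))"
      using pow[of "m - 1"] m by (cases m) auto
    also have "g (bs ! (m - 1)) $ k = (\<Sum>i<m. - coeff P i * bs ! i $ k)"
      using m k P by (subst coord) (auto simp: companion_mat_def)
    finally show "poly_act m g P w $ k = 0\<^sub>v m $ k"
      using k by (simp add: sum_negf)
  qed (use w in \<open>simp add: carrier_vecD[OF poly_act_carrier]\<close>)
  let ?W = "{v \<in> carrier_vec m. poly_act m g P v = 0\<^sub>v m}"
  have "set bs \<subseteq> ?W"
  proof
    fix x assume "x \<in> set bs"
    then obtain j where j: "j < m" "x = bs ! j" using len by (auto simp: in_set_conv_nth)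
    have "x = poly_act m g (monom 1 j) w" using j pow poly_act_monom[OF w] by simp
    then have "poly_act m g P x = poly_act m g (monom 1 j) (poly_act m g P w)"
      using w by (simp only: poly_act_mult[symmetric] mult.commute)
    then show "x \<in> ?W" using Pw j bs by (simp add: poly_act_zero_vec)
  qed
  moreover have "submodule class_ring ?W ?V"
  proof (rule submodule.intro)
    show "Module.module class_ring ?V" by (rule vec_module)
  qed (auto simp: module_vec_simps class_ring_simps poly_act_add_vec poly_act_smult_vec
      poly_act_zero_vec smult_zero_vec)
  ultimately have "LinearCombinations.module.span class_ring ?V (set bs) \<subseteq> ?W" by (rule LinearCombinations.module.span_is_subset[OF vec_module])
  moreover have "LinearCombinations.module.span class_ring ?V (set bs) = carrier_vec m"
    using basis unfolding lin.V.basis_def by (simp add: module_vec_simps)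
  ultimately show ?thesis using v by auto
qed

lemma poly_act_mod:
  assumes "\<And>v. v \<in> carrier_vec m \<Longrightarrow> poly_act m g P v = 0\<^sub>v m" "v \<in> carrier_vec m"
  shows "poly_act m g (R mod P) v = poly_act m g R v"
proof -
  have "poly_act m g R v = poly_act m g (R div P * P + R mod P) v" by simp
  also have "\<dots> = poly_act m g (R mod P) v"
    using assms by (simp only: poly_act_add poly_act_mult poly_act_zero_vec poly_act_carrier left_zero_vec)
  finally show ?thesis by simp
qed

end

section \<open>The cascade as a tower\<close>

lemma bit_vec_add_cancel:
  fixes u v w :: "bit vec"
  assumes "u \<in> carrier_vec m" "v \<in> carrier_vec m" "w \<in> carrier_vec m" "u + w = v + w"
  shows "u = v"
proof (rule eq_vecI)
  fix i assume i: "i < dim_vec v"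
  then have "u $ i + w $ i = v $ i + w $ i"
    using arg_cong[OF assms(4), of "\<lambda>x. x $ i"] assms(1-3) by (simp only: index_add_vec carrier_vecD)
  then show "u $ i = v $ i" by (simp only: add_right_cancel)
qed (use assms in simp)

lemma bit_vec_add_self:
  fixes v :: "bit vec"
  assumes "v \<in> carrier_vec m"
  shows "v + v = 0\<^sub>v m"
proof (rule eq_vecI)
  fix i assume "i < dim_vec (0\<^sub>v m :: bit vec)"
  then show "(v + v) $ i = 0\<^sub>v m $ i" using assms by (cases "v $ i") auto
qed (use assms in simp)

lemma card_bit_carrier_vec: "card (carrier_vec n :: bit vec set) = 2 ^ n"
  and finite_bit_carrier_vec: "finite (carrier_vec n :: bit vec set)"
proof -
  have "bij_betw vec_of_list {xs :: bit list. set xs \<subseteq> UNIV \<and> length xs = n} (carrier_vec n)"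
    by (rule bij_betw_byWitness[where f' = list_of_vec])
      (auto simp: list_vec vec_list, metis carrier_vec_dim_vec dim_vec_of_list)
  moreover have "finite {xs :: bit list. set xs \<subseteq> UNIV \<and> length xs = n}"
    by (rule finite_lists_length_eq) (simp add: bit_UNIV)
  moreover have "card {xs :: bit list. set xs \<subseteq> UNIV \<and> length xs = n} = 2 ^ n"
    by (subst card_lists_length_eq) (simp_all add: bit_UNIV numeral_2_eq_2)
  ultimately show "card (carrier_vec n :: bit vec set) = 2 ^ n" "finite (carrier_vec n :: bit vec set)"
    by (auto simp: bij_betw_same_card[symmetric] dest: bij_betw_finite)
qed

lemma fsr_carrier [simp]: "fsr n f1 x \<in> carrier_vec n"
  by (simp add: fsr_def)

lemma fsr_index: "k + 1 < m \<Longrightarrow> fsr m g1 x $ k = x $ (k + 1)"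
  by (simp add: fsr_def less_diff_conv)

lemma fsr_funpow_index:
  assumes "k + i < m"
  shows "(fsr m g1 ^^ i) x $ k = x $ (k + i)"
  using assms
proof (induction i arbitrary: k)
  case (Suc i)
  then show ?case by (simp add: fsr_index)
qed simp

text \<open>The states of the linear register form a module over the polynomials, on which \<open>X\<close> acts as
  the register does. The last unit vector generates this module: it is the vector that an input
  bit is added along, and it plays the role of the residue \<open>1\<close>.\<close>

locale fsr_cascade =
  fixes m n :: nat and g1 f1 :: "bit vec \<Rightarrow> bit" and P :: "bit poly"
  assumes m: "m > 0" and n: "n > 0"
    and linear: "linear_map class_ring (module_vec TYPE(bit) m) (module_vec TYPE(bit) m) (fsr m g1)"
    and bij_g: "bij_betw (fsr m g1) (carrier_vec m) (carrier_vec m)"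
    and P: "lead_coeff P = 1" "degree P = m"
    and rep: "represented_by m (fsr m g1) (companion_mat P)"
    and bij_f: "bij_betw (fsr n f1) (carrier_vec n) (carrier_vec n)"
    and cyc: "cyclic_on (fsr n f1) (carrier_vec n)"
begin

abbreviation "g \<equiv> fsr m g1"
abbreviation "f \<equiv> fsr n f1"
abbreviation "u \<equiv> (unit_vec m (m - Suc 0) :: bit vec)"

abbreviation state_of :: "bit poly \<Rightarrow> bit vec" where
  "state_of R \<equiv> poly_act m g R u"

lemma state_of_carrier [simp]: "state_of R \<in> carrier_vec m"
  by (rule poly_act_carrier[OF linear]) simp

lemma state_of_mod: "state_of (R mod P) = state_of R"
  by (rule poly_act_mod[OF linear companion_annihilates[OF linear P m rep]]) simp_all

lemma state_of_shift: "g (state_of R) + a \<cdot>\<^sub>v u = state_of ([:0, 1:] * R + [:a:])"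
proof -
  have "[:0, 1:] * R + [:a:] = pCons a R" by simp
  moreover have "g (state_of R) \<in> carrier_vec m" by simp
  ultimately show ?thesis
    using poly_act_pCons[OF linear, of u a R] comm_add_vec[of "g (state_of R)" m "a \<cdot>\<^sub>v u"] by simp
qed

text \<open>Each step moves the single nonzero entry of the last unit vector one place to the left, with
  arbitrary entries appearing only to its right. So the leading term of \<open>R\<close>, of degree
  \<open>d\<close>, is the only one that reaches the place \<open>d\<close> before the last.\<close>

lemma state_of_eq_0D:
  assumes "\<forall>i\<ge>m. coeff R i = 0" "state_of R = 0\<^sub>v m"
  shows "R = 0"
proof (rule ccontr)
  assume R: "R \<noteq> 0"
  define d where "d = degree R"
  have "coeff R d \<noteq> 0" using R by (simp add: d_def)
  then have d: "d < m" using assms(1) not_less by blast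
  have "0 = state_of R $ (m - 1 - d)" using assms(2) d by simp
  also have "\<dots> = (\<Sum>i\<le>d. coeff R i * (g ^^ i) u $ (m - 1 - d))"
    using poly_act_index[OF linear, of u "m - 1 - d" "coeff R" "\<lambda>i. i" "{..d}"] m
    by (simp add: poly_as_sum_of_monoms d_def)
  also have "\<dots> = (\<Sum>i\<le>d. if i = d then coeff R i else 0)"
  proof (rule sum.cong[OF refl])
    fix i assume "i \<in> {..d}"
    then have i: "m - 1 - d + i < m" "m - 1 - d + i = m - 1 \<longleftrightarrow> i = d" using d by auto
    then show "coeff R i * (g ^^ i) u $ (m - 1 - d) = (if i = d then coeff R i else 0)"
      using m by (simp add: fsr_funpow_index)
  qed
  also have "\<dots> = coeff R d" by simp
  finally show False using \<open>coeff R d \<noteq> 0\<close> by simp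
qed

lemma P_nonzero: "P \<noteq> 0"
  using P m by auto

lemma inj_on_state_of: "inj_on state_of (residues P)"
proof (rule inj_onI)
  fix R S assume RS: "R \<in> residues P" "S \<in> residues P" "state_of R = state_of S"
  have "state_of (R + S) = state_of R + state_of R"
    using poly_act_add[OF linear, of u R S] RS(3) by simp
  also have "\<dots> = 0\<^sub>v m" by (rule bit_vec_add_self) (rule state_of_carrier)
  finally have "R + S = 0"
    using RS(1,2) P by (intro state_of_eq_0D) (auto simp: residues_eq[OF P_nonzero])
  then show "R = S" using bit_poly_add_self[of S] by (metis add_right_cancel)
qed

text \<open>If \<open>X\<close> divided \<open>P\<close>, the register would send the nonzero state belonging to
  \<open>P div X\<close> to zero, although it is injective.\<close>

lemma coprime_X: "coprime [:0, 1:] P"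
proof (rule coprimeI)
  fix D assume D: "D dvd [:0, 1:]" "D dvd P"
  obtain a S where S: "P = pCons a S" by (cases P)
  have "a \<noteq> 0"
  proof
    assume a: "a = 0"
    have "state_of P = 0\<^sub>v m"
      by (rule companion_annihilates[OF linear P m rep]) simp
    then have "g (state_of S) = g (0\<^sub>v m)"
      using state_of_shift[of S 0] S a lin_zero[OF linear]
      by (simp add: zero_smult_vec[of _ m])
    then have "state_of S = 0\<^sub>v m"
      using bij_g by (auto simp: bij_betw_def dest: inj_onD)
    moreover have "\<forall>i\<ge>m. coeff S i = 0"
    proof (intro allI impI)
      fix i assume "i \<ge> m"
      then have "coeff P (Suc i) = 0" using P(2) by (intro coeff_eq_0) simp
      then show "coeff S i = 0" using S by simp
    qed
    ultimately have "S = 0" by (intro state_of_eq_0D)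
    then show False using P_nonzero S a by simp
  qed
  then have "1 = P - [:0, 1:] * S" using S by simp
  then show "D dvd 1" using D by (metis dvd_diff dvd_mult2)
qed

lemma f_period: "(f ^^ 2 ^ n) (0\<^sub>v n) = 0\<^sub>v n"
  and inj_f_orbit: "inj_on (\<lambda>t. (f ^^ t) (0\<^sub>v n)) {..<2 ^ n}"
  and f_orbit: "carrier_vec n = (\<lambda>t. (f ^^ t) (0\<^sub>v n)) ` {..<2 ^ n}"
proof -
  have orb: "orbit f (0\<^sub>v n) = carrier_vec n" using cyc by (rule orbit_cyclic_eq3) simp
  then have self: "0\<^sub>v n \<in> orbit f (0\<^sub>v n)" by simp
  show per: "(f ^^ 2 ^ n) (0\<^sub>v n) = 0\<^sub>v n"
    using funpow_fixes_iff_card_orbit_dvd[OF self] orb card_bit_carrier_vec[of n] by simp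
  show img: "carrier_vec n = (\<lambda>t. (f ^^ t) (0\<^sub>v n)) ` {..<2 ^ n}"
    using orbit_altdef_bounded[OF per] orb by auto
  show "inj_on (\<lambda>t. (f ^^ t) (0\<^sub>v n)) {..<2 ^ n}"
    using card_bit_carrier_vec[of n] unfolding img by (intro eq_card_imp_inj_on) auto
qed

text \<open>The first \<open>t\<close> bits that the nonlinear register outputs from its zero state, the latest
  one as the constant coefficient.\<close>

definition input_poly :: "nat \<Rightarrow> bit poly" where
  "input_poly t = (\<Sum>s<t. monom ((f ^^ s) (0\<^sub>v n) $ 0) (t - 1 - s))"

lemma input_poly_Suc: "input_poly (Suc t) = [:0, 1:] * input_poly t + [:(f ^^ t) (0\<^sub>v n) $ 0:]"
proof -
  have "[:0, 1:] * input_poly t = (\<Sum>s<t. monom ((f ^^ s) (0\<^sub>v n) $ 0) (t - s))"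
    unfolding input_poly_def sum_distrib_left
  proof (rule sum.cong[OF refl])
    fix s assume "s \<in> {..<t}"
    then have "t - s = Suc (t - 1 - s)" by auto
    then show "[:0, 1:] * monom ((f ^^ s) (0\<^sub>v n) $ 0) (t - 1 - s) = monom ((f ^^ s) (0\<^sub>v n) $ 0) (t - s)"
      by (simp add: monom_Suc)
  qed
  then show ?thesis by (simp add: input_poly_def monom_0)
qed

lemma chi_eq_input_poly: "chi n f = input_poly (2 ^ n)"
proof -
  have "{0..2 ^ n - 1} = {..<2 ^ n :: nat}"
    using lessThan_Suc_atMost[of "2 ^ n - 1"] by (simp add: atLeast0AtMost)
  then show ?thesis by (simp add: chi_def input_poly_def)
qed

lemma coeff_input_poly:
  assumes "s < t"
  shows "coeff (input_poly t) (t - 1 - s) = (f ^^ s) (0\<^sub>v n) $ 0"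
proof -
  have "coeff (input_poly t) (t - 1 - s) = (\<Sum>s'<t. if s' = s then (f ^^ s') (0\<^sub>v n) $ 0 else 0)"
    unfolding input_poly_def coeff_sum
    by (intro sum.cong) (use assms in auto)
  then show ?thesis using assms by simp
qed

lemma degree_chi: "degree (chi n f) < 2 ^ n"
proof -
  have "degree (chi n f) \<le> 2 ^ n - 1"
    unfolding chi_def by (intro degree_sum_le) (auto intro!: order_trans[OF degree_monom_le])
  then show ?thesis by (metis One_nat_def Suc_pred le_imp_less_Suc zero_less_numeral zero_less_power)
qed

text \<open>The first unit vector occurs among the states of the full cycle, and it outputs a one.\<close>

lemma chi_nonzero: "chi n f \<noteq> 0"
proof
  assume "chi n f = 0"
  moreover have "unit_vec n 0 \<in> (\<lambda>t. (f ^^ t) (0\<^sub>v n)) ` {..<2 ^ n}"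
    unfolding f_orbit[symmetric] by simp
  then obtain s where s: "s < 2 ^ n" "(f ^^ s) (0\<^sub>v n) = unit_vec n 0" by auto
  ultimately show False using coeff_input_poly[OF s(1)] n by (simp add: chi_eq_input_poly)
qed

abbreviation "F \<equiv> cascade n f1 m g1"

lemma cascade_append:
  assumes "x \<in> carrier_vec m" "y \<in> carrier_vec n"
  shows "F (x @\<^sub>v y) = (g x + (y $ 0) \<cdot>\<^sub>v u) @\<^sub>v f y"
proof -
  have "vec_first (x @\<^sub>v y) m = x" "vec_last (x @\<^sub>v y) n = y"
    using assms by (auto simp: vec_first_def vec_last_def)
  moreover have "vec m (\<lambda>i. if i < m - 1 then x $ (i + 1) else g1 x + y $ 0) = g x + (y $ 0) \<cdot>\<^sub>v u"
    using m by (intro eq_vecI) (auto simp: fsr_def)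
  ultimately show ?thesis by (simp add: cascade_def)
qed

lemma carrier_vec_append:
  assumes "z \<in> carrier_vec (m + n)"
  obtains x y where "x \<in> carrier_vec m" "y \<in> carrier_vec n" "z = x @\<^sub>v y"
  using assms vec_first_last_append[of z m n] vec_first_carrier vec_last_carrier by metis

lemma bij_betw_cascade: "bij_betw F (carrier_vec (m + n)) (carrier_vec (m + n))"
proof -
  have inj: "inj_on F (carrier_vec (m + n))"
  proof (rule inj_onI)
    fix z z' :: "bit vec" assume z: "z \<in> carrier_vec (m + n)" "z' \<in> carrier_vec (m + n)" "F z = F z'"
    obtain x y where xy: "x \<in> carrier_vec m" "y \<in> carrier_vec n" "z = x @\<^sub>v y"
      using carrier_vec_append[OF z(1)] .
    obtain x' y' where xy': "x' \<in> carrier_vec m" "y' \<in> carrier_vec n" "z' = x' @\<^sub>v y'"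
      using carrier_vec_append[OF z(2)] .
    have c: "g x + (y $ 0) \<cdot>\<^sub>v u \<in> carrier_vec m" "g x' + (y' $ 0) \<cdot>\<^sub>v u \<in> carrier_vec m" by auto
    have "g x + (y $ 0) \<cdot>\<^sub>v u = g x' + (y' $ 0) \<cdot>\<^sub>v u" and fy: "f y = f y'"
      using z(3) unfolding xy(3) xy'(3) cascade_append[OF xy(1,2)] cascade_append[OF xy'(1,2)]
      using append_vec_eq[OF c] by auto
    moreover have y: "y = y'" using fy bij_f xy xy' by (auto simp: bij_betw_def dest: inj_onD)
    ultimately have "g x = g x'"
      using bit_vec_add_cancel[of "g x" m "g x'" "(y $ 0) \<cdot>\<^sub>v u"] by simp
    then have "x = x'" using bij_g xy xy' by (auto simp: bij_betw_def dest: inj_onD)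
    then show "z = z'" using y xy xy' by simp
  qed
  have "F z \<in> carrier_vec (m + n)" if "z \<in> carrier_vec (m + n)" for z
    using that by (elim carrier_vec_append) (simp add: cascade_append)
  then have "F ` carrier_vec (m + n) = carrier_vec (m + n)"
    using inj finite_bit_carrier_vec by (intro endo_inj_surj) auto
  with inj show ?thesis by (simp add: bij_betw_def)
qed

text \<open>A step of the cascade multiplies the polynomial of the linear register by \<open>X\<close> and adds the
  input bit as a constant, so the input bits accumulate in \<open>input_poly\<close>.\<close>

lemma funpow_cascade:
  "(F ^^ t) (state_of R @\<^sub>v 0\<^sub>v n) = state_of ([:0, 1:] ^ t * R + input_poly t) @\<^sub>v (f ^^ t) (0\<^sub>v n)"
proof (induction t)
  case 0
  then show ?case by (simp add: input_poly_def)
next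
  case (Suc t)
  have "(f ^^ t) (0\<^sub>v n) \<in> carrier_vec n"
    using bij_betw_funpow[OF bij_f, of t] by (meson bij_betwE zero_carrier_vec)
  then have "(F ^^ Suc t) (state_of R @\<^sub>v 0\<^sub>v n) =
      state_of ([:0, 1:] * ([:0, 1:] ^ t * R + input_poly t) + [:(f ^^ t) (0\<^sub>v n) $ 0:]) @\<^sub>v f ((f ^^ t) (0\<^sub>v n))"
    using Suc by (simp only: funpow.simps o_apply cascade_append state_of_carrier state_of_shift)
  also have "[:0, 1:] * ([:0, 1:] ^ t * R + input_poly t) + [:(f ^^ t) (0\<^sub>v n) $ 0:] =
      [:0, 1:] ^ Suc t * R + input_poly (Suc t)"
    by (simp only: input_poly_Suc power_Suc distrib_left mult.assoc add.assoc)
  finally show ?case by (simp only: funpow.simps o_apply)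
qed

text \<open>The nonlinear register tells the floor: a state of the cascade is reached in a unique way by
  \<open>s < 2 ^ n\<close> steps from a state with zero second part. This identifies the cascade with a
  tower, over the return map \<open>R \<mapsto> X ^ 2 ^ n * R + chi\<close>.\<close>

theorem cycle_type_cascade:
  "cycle_type (carrier_vec (m + n)) F =
    BU (2 ^ n) (cycle_type (residues P) (affine_mod P ([:0, 1:] ^ 2 ^ n) (chi n f)))"
proof -
  let ?N = "2 ^ n :: nat" and ?A = "affine_mod P ([:0, 1:] ^ 2 ^ n) (chi n f)"
  let ?\<phi> = "\<lambda>(R, s). (F ^^ s) (state_of R @\<^sub>v 0\<^sub>v n)"
  have cop: "coprime ([:0, 1:] ^ ?N) P" using coprime_X by simp
  note bij_A = bij_betw_affine_mod[OF P_nonzero cop, of "chi n f"]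
  have fin: "finite (residues P)" by (rule finite_residues[OF P_nonzero])
  note bij_Fs = bij_betw_funpow[OF bij_betw_cascade]
  have inj: "inj_on ?\<phi> (residues P \<times> {..<?N})"
  proof (rule inj_onI)
    fix p q assume pq: "p \<in> residues P \<times> {..<?N}" "q \<in> residues P \<times> {..<?N}" "?\<phi> p = ?\<phi> q"
    obtain R s S t where RS: "p = (R, s)" "q = (S, t)" by (cases p, cases q)
    have "(f ^^ s) (0\<^sub>v n) = (f ^^ t) (0\<^sub>v n)"
      using pq(3) append_vec_eq[OF state_of_carrier state_of_carrier] unfolding RS
      by (simp add: funpow_cascade)
    then have "s = t" using inj_f_orbit pq(1,2) unfolding RS by (auto dest: inj_onD)
    then have "(F ^^ s) (state_of R @\<^sub>v 0\<^sub>v n) = (F ^^ s) (state_of S @\<^sub>v 0\<^sub>v n)"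
      using pq(3) unfolding RS by simp
    then have "state_of R @\<^sub>v 0\<^sub>v n = state_of S @\<^sub>v 0\<^sub>v n"
      using bij_Fs[of s] by (auto simp: bij_betw_def dest: inj_onD)
    then have "state_of R = state_of S"
      using append_vec_eq[OF state_of_carrier state_of_carrier] by blast
    then show "p = q" using inj_on_state_of pq(1,2) \<open>s = t\<close> unfolding RS by (auto dest: inj_onD)
  qed
  have "?\<phi> ` (residues P \<times> {..<?N}) = carrier_vec (m + n)"
  proof (rule card_subset_eq[OF finite_bit_carrier_vec])
    show "?\<phi> ` (residues P \<times> {..<?N}) \<subseteq> carrier_vec (m + n)"
    proof
      fix z assume "z \<in> ?\<phi> ` (residues P \<times> {..<?N})"
      then obtain R s where "z = (F ^^ s) (state_of R @\<^sub>v 0\<^sub>v n)" by auto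
      then show "z \<in> carrier_vec (m + n)" using bij_Fs[of s] by (auto simp: bij_betw_def)
    qed
    show "card (?\<phi> ` (residues P \<times> {..<?N})) = card (carrier_vec (m + n) :: bit vec set)"
      by (simp only: card_image[OF inj] card_cartesian_product card_residues[OF P_nonzero]
          card_bit_carrier_vec P(2) card_lessThan power_add)
  qed
  with inj have bij: "bij_betw ?\<phi> (residues P \<times> {..<?N}) (carrier_vec (m + n))"
    by (simp add: bij_betw_def)
  have "cycle_type (carrier_vec (m + n)) F = cycle_type (residues P \<times> {..<?N}) (tower ?N ?A)"
  proof (rule cycle_type_conj[OF _ bij_betw_tower[OF fin bij_A] bij])
    fix p assume p: "p \<in> residues P \<times> {..<?N}"
    obtain R s where Rs: "p = (R, s)" by (cases p)
    show "?\<phi> (tower ?N ?A p) = F (?\<phi> p)"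
    proof (cases "Suc s < ?N")
      case False
      then have s: "Suc s = ?N" using p unfolding Rs by auto
      have "F (?\<phi> p) = (F ^^ Suc s) (state_of R @\<^sub>v 0\<^sub>v n)" by (simp add: Rs)
      also have "\<dots> = state_of ([:0, 1:] ^ ?N * R + chi n f) @\<^sub>v 0\<^sub>v n"
        unfolding s funpow_cascade f_period chi_eq_input_poly ..
      finally show ?thesis using False by (simp add: Rs tower_def affine_mod_def state_of_mod)
    qed (simp add: Rs tower_def)
  qed (use fin in auto)
  also have "\<dots> = BU ?N (cycle_type (residues P) ?A)"
    by (rule cycle_type_tower[OF fin bij_A]) simp
  finally show ?thesis .
qed

end

section \<open>The cycle types of the cascade and of its return map\<close>

lemma coprime_irreducible_bit_poly:
  fixes p q :: "bit poly"
  assumes "irreducible p" "irreducible q" "p \<noteq> q"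
  shows "coprime p q"
proof -
  have "\<not> p dvd q"
  proof
    assume "p dvd q"
    then obtain c where c: "q = p * c" by auto
    then have "c dvd 1" using assms(1,2) irreducibleD irreducible_not_unit by blast
    then obtain a where "c = [:a:]" "a \<noteq> 0" by (auto simp: is_unit_poly_iff dvd_field_iff)
    then show False using c assms(3) by simp
  qed
  then show ?thesis
    using assms(1) irreducible_imp_prime_elem prime_elem_imp_coprime by blast
qed

lemma funpow_mult_X: "(mult_X P ^^ k) (residue_class P R) = residue_class P ([:0, 1:] ^ k * R)"
  by (induction k) (simp_all only: funpow.simps id_apply o_apply mult_X_residue_class power_0 power_Suc mult_1_left mult.assoc)

lemma wei_xu_prod_cong:
  "(\<And>i. i \<in> {1..k} \<Longrightarrow> \<gamma> i = \<delta> i) \<Longrightarrow> wei_xu_prod \<gamma> k = wei_xu_prod \<delta> k"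
  by (induction k) auto

theorem theorem4p2:
  fixes n m r e0 a b :: nat
    and f1 g1 :: "bit vec \<Rightarrow> bit"
    and f g :: "bit vec \<Rightarrow> bit vec"
    and P P0 Pplus :: "bit poly"
    and Q :: "nat \<Rightarrow> bit poly"
    and e :: "nat \<Rightarrow> nat"
  assumes "n > 0" and "m > 0"
    and "f = fsr n f1" and "bij_betw f (carrier_vec n) (carrier_vec n)"
    and "g = fsr m g1" and "bij_betw g (carrier_vec m) (carrier_vec m)"
    and "cyclic_on f (carrier_vec n)"
    and "linear_map class_ring (module_vec TYPE(bit) m) (module_vec TYPE(bit) m) g"
    and "lead_coeff P = 1" and "degree P = m" and "represented_by m g (companion_mat P)"
    and "P = [:-1, 1:] ^ e0 * (\<Prod>i = 1..r. Q i ^ e i)"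
    and "\<And>i. i \<in> {1..r} \<Longrightarrow> e i > 0"
    and "\<And>i. i \<in> {1..r} \<Longrightarrow> lead_coeff (Q i) = 1 \<and> irreducible (Q i) \<and> Q i \<noteq> [:-1, 1:]"
    and "inj_on Q {1..r}"
    and "P0 = [:-1, 1:] ^ e0" and "Pplus = (\<Prod>i = 1..r. Q i ^ e i)"
    and "e0 = a * 2 ^ n + b" and "b < 2 ^ n"
  shows
    "(cycle_type (carrier_vec (m + n)) (cascade n f1 m g1) =
        BU (2 ^ n) (cycle_type (carrier (quot_ring P)) (Gamma n f P))) \<and>
     (cycle_type (carrier (quot_ring P)) (Gamma n f P) =
        cycle_type (carrier (quot_ring P0)) (Gamma n f P0) \<otimes>\<^sub>W
        cycle_type (carrier (quot_ring Pplus)) (Gamma n f Pplus)) \<and>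
     (cycle_type (carrier (quot_ring Pplus)) (mult_X Pplus) =
        wei_xu_prod (\<lambda>i. cycle_type (carrier (quot_ring (Q i ^ e i))) (mult_X (Q i ^ e i))) r) \<and>
     (cycle_type (carrier (quot_ring Pplus)) (Gamma n f Pplus) =
        cycle_type (carrier (quot_ring Pplus)) (mult_X Pplus ^^ (2 ^ n))) \<and>
     (cycle_type (carrier (quot_ring Pplus)) (mult_X Pplus ^^ (2 ^ n)) =
        ct_iterate (2 ^ n) (cycle_type (carrier (quot_ring Pplus)) (mult_X Pplus))) \<and>
     (cycle_type (carrier (quot_ring P0)) (Gamma n f P0) =
        (if e0 = 0 then ct_var 1
         else if int n \<ge> \<lceil>log 2 (real e0)\<rceil> then
           (if P0 dvd chi n f then ct_var 1 ^ (2 ^ e0)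
            else ct_var 2 ^ (2 ^ (e0 - 1)))
         else if log 2 (real a + 1) \<notin> \<int> then
           ct_var (2 ^ (nat \<lfloor>log 2 (real a)\<rfloor> + 1)) ^ (2 ^ (e0 - nat \<lfloor>log 2 (real a)\<rfloor> - 1))
         else if [:-1, 1:] ^ b dvd chi n f then
           ct_var (a + 1) ^ (2 ^ e0 div (a + 1))
         else ct_var (2 * a + 2) ^ (2 ^ (e0 - 1) div (a + 1))))"
proof -
  let ?X = "[:0, 1:] :: bit poly" and ?Y = "[:-1, 1:] :: bit poly" and ?N = "2 ^ n :: nat"
  interpret C: fsr_cascade m n g1 f1 P
    by (rule fsr_cascade.intro[OF assms(2,1) assms(8,6)[unfolded assms(5)] assms(9,10)
          assms(11)[unfolded assms(5)] assms(4,7)[unfolded assms(3)]])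
  note f = assms(3)
  have X: "?X = 1 + ?Y" by (simp add: one_pCons)
  have XN: "?X ^ ?N = 1 + ?Y ^ ?N" unfolding X by (rule bit_poly_one_add_power_two_power)
  have P: "P = P0 * Pplus" using assms(12,16,17) by simp
  have nz: "P0 \<noteq> 0" "Pplus \<noteq> 0" using C.P_nonzero P by auto
  have cop: "coprime ?X P0" "coprime ?X Pplus" using C.coprime_X unfolding P by simp_all
  have copN: "coprime (?X ^ ?N) P" "coprime (?X ^ ?N) P0" "coprime (?X ^ ?N) Pplus"
    using C.coprime_X cop by simp_all
  have Q: "irreducible (Q i)" "Q i \<noteq> ?Y" "Q i \<noteq> 0" if "i \<in> {1..r}" for i
    using assms(14)[OF that] by auto
  have Y_irred: "irreducible ?Y"
    by (rule irreducible_linear_field_poly) simp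
  have Y_plus: "coprime ?Y Pplus"
    unfolding assms(17) using Q coprime_irreducible_bit_poly[OF Y_irred]
    by (intro prod_coprime_right) (metis coprime_power_right_iff)
  have Gam: "cycle_type (carrier (quot_ring S)) (Gamma n f S) =
      cycle_type (residues S) (affine_mod S (?X ^ ?N) (chi n f))" if "S \<noteq> 0" "coprime (?X ^ ?N) S" for S
    using that by (rule cycle_type_quot_ring) (rule Gamma_residue_class)
  have alp: "cycle_type (carrier (quot_ring S)) (mult_X S) = cycle_type (residues S) (affine_mod S ?X 0)"
    if "S \<noteq> 0" "coprime ?X S" for S
    using that by (rule cycle_type_quot_ring) (simp only: mult_X_residue_class add_0_right)
  have 1: "cycle_type (carrier_vec (m + n)) (cascade n f1 m g1) =
      BU ?N (cycle_type (carrier (quot_ring P)) (Gamma n f P))"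
    unfolding Gam[OF C.P_nonzero copN(1)] using C.cycle_type_cascade f by simp
  have 2: "cycle_type (carrier (quot_ring P)) (Gamma n f P) =
      cycle_type (carrier (quot_ring P0)) (Gamma n f P0) \<otimes>\<^sub>W
      cycle_type (carrier (quot_ring Pplus)) (Gamma n f Pplus)"
    unfolding Gam[OF C.P_nonzero copN(1)] Gam[OF nz(1) copN(2)] Gam[OF nz(2) copN(3)]
    unfolding P using nz copN Y_plus assms(16) by (intro cycle_type_affine_mod_mult) simp_all
  have Qe: "Q i ^ e i \<noteq> 0" "coprime ?X (Q i ^ e i)" if "i \<in> {1..r}" for i
  proof -
    show "Q i ^ e i \<noteq> 0" using Q(3)[OF that] by simp
    have "Q i ^ e i dvd Pplus" unfolding assms(17) using that by (intro dvd_prodI) auto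
    then show "coprime ?X (Q i ^ e i)" using cop(2) coprime_divisors dvd_refl by blast
  qed
  have 3: "cycle_type (carrier (quot_ring Pplus)) (mult_X Pplus) =
      wei_xu_prod (\<lambda>i. cycle_type (carrier (quot_ring (Q i ^ e i))) (mult_X (Q i ^ e i))) r"
  proof -
    have "cycle_type (carrier (quot_ring Pplus)) (mult_X Pplus) =
        wei_xu_prod (\<lambda>i. cycle_type (residues (Q i ^ e i)) (affine_mod (Q i ^ e i) ?X 0)) r"
      unfolding alp[OF nz(2) cop(2)] unfolding assms(17)
    proof (rule cycle_type_affine_mod_prod)
      show "coprime (Q i ^ e i) (Q j ^ e j)" if "i \<in> {1..r}" "j \<in> {1..r}" "i \<noteq> j" for i j
      proof -
        have "Q i \<noteq> Q j" using that assms(15) by (auto dest: inj_onD)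
        then have "coprime (Q i) (Q j)" using that Q(1) coprime_irreducible_bit_poly by blast
        then show ?thesis by simp
      qed
    qed (use Qe in auto)
    also have "\<dots> = wei_xu_prod (\<lambda>i. cycle_type (carrier (quot_ring (Q i ^ e i))) (mult_X (Q i ^ e i))) r"
      by (rule wei_xu_prod_cong) (simp only: alp[OF Qe])
    finally show ?thesis .
  qed
  have 4: "cycle_type (carrier (quot_ring Pplus)) (Gamma n f Pplus) =
      cycle_type (carrier (quot_ring Pplus)) (mult_X Pplus ^^ ?N)"
  proof -
    \<comment> \<open>\<open>X ^ N - 1\<close> is the power \<open>(X - 1) ^ N\<close>, which has no factor in common with \<open>Pplus\<close>.\<close>
    have "coprime (?X ^ ?N - 1) Pplus" using Y_plus by (simp only: XN add_diff_cancel_left') simp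
    then have "cycle_type (carrier (quot_ring Pplus)) (Gamma n f Pplus) =
        cycle_type (residues Pplus) (affine_mod Pplus (?X ^ ?N) 0)"
      unfolding Gam[OF nz(2) copN(3)] by (rule cycle_type_affine_mod_translate[OF nz(2) copN(3)])
    also have "\<dots> = cycle_type (carrier (quot_ring Pplus)) (mult_X Pplus ^^ ?N)"
      by (rule cycle_type_quot_ring[OF nz(2) copN(3), symmetric]) (simp only: funpow_mult_X add_0_right)
    finally show ?thesis .
  qed
  have 5: "cycle_type (carrier (quot_ring Pplus)) (mult_X Pplus ^^ ?N) =
      ct_iterate (2 ^ n) (cycle_type (carrier (quot_ring Pplus)) (mult_X Pplus))"
  proof -
    have "finite (carrier (quot_ring Pplus))"
      using bij_betw_finite[OF bij_betw_residue_class] finite_residues[OF nz(2)] by blast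
    moreover have "bij_betw (mult_X Pplus) (carrier (quot_ring Pplus)) (carrier (quot_ring Pplus))"
      by (rule bij_betw_quot_ring[OF nz(2) cop(2), of _ 0]) (simp only: mult_X_residue_class add_0_right)
    ultimately show ?thesis by (simp add: cycle_type_funpow)
  qed
  note 6 = cycle_type_unipotent[OF _ C.chi_nonzero C.degree_chi assms(1,18,19), of ?Y, folded f]
  show ?thesis
    by (intro conjI 1 2 3 4 5) (unfold Gam[OF nz(1) copN(2)], unfold XN assms(16), rule 6, simp)
qed

end
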